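(* For all sufficiently large $K\in(0,\infty)$, $$\mathbb{P}\left(\exists\, \tau\in[0,1] \text{ such that } S_0^\tau \text{ is } K^+\text{-subdiffusive}\right)>0.$$
   Context: Let $\mathbb{Z}^2_{even}=\{(x,t)\in\mathbb{Z}^2: x+t \text{ is even}\}$. Dynamical discrete web: the processes $(\xi_z^\tau)_{\tau\ge 0}$, $z\in\mathbb{Z}^2_{even}$, are independent, right-continuous, $\{-1,+1\}$-valued; for each $z$, $\xi_z^0$ is uniform on $\{-1,+1\}$, and at each ring of a rate-one Poisson clock at $z$ the value is replaced by a fresh independent uniform $\{-1,+1\}$ value. For each $\tau\geq 0$, $S_0^\tau$ is the path with $S_0^\tau(0)=0$, $S_0^\tau(t+1)=S_0^\tau(t)+\xi^\tau_{(S_0^\tau(t),t)}$ for integers $t\ge 0$, linearly interpolated between integer times. For $K\in(0,\infty)$, a path $\pi$ starting at $0$ at time $0$ is $K^+$-subdiffusive iff there exists $j\ge 0$ such that $\pi(t)\ge -j-K\sqrt{t}$ for all $t>0$. *)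

theory Defs
  imports "HOL-Probability.Probability"
begin

definition even_lattice :: "(int \<times> int) set"
  where "even_lattice = {(x, t). even (x + t)}"

text \<open>Homogeneous Poisson process on \<open>[0, \<infinity>)\<close>, given by its counting process:
  \<open>N t\<close> is the number of rings in the time interval \<open>(0, t]\<close>. The differences below are
  subtractions of natural numbers, which do not truncate because the paths are monotone.\<close>

definition (in prob_space) poisson_process :: "real \<Rightarrow> (real \<Rightarrow> 'a \<Rightarrow> nat) \<Rightarrow> bool"
  where "poisson_process r N \<longleftrightarrow>
    (\<forall>t\<ge>0. random_variable (count_space UNIV) (N t)) \<and>
    (\<forall>\<omega>\<in>space M. N 0 \<omega> = 0 \<and> mono_on {0..} (\<lambda>t. N t \<omega>) \<and>
       (\<forall>t\<ge>0. continuous (at_right t) (\<lambda>s. N s \<omega>))) \<and>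
    (\<forall>s t. 0 \<le> s \<and> s < t \<longrightarrow>
       distr M (count_space UNIV) (\<lambda>\<omega>. N t \<omega> - N s \<omega>) = measure_pmf (poisson_pmf (r * (t - s)))) \<and>
    (\<forall>u n. (0::real) \<le> u 0 \<and> mono u \<longrightarrow>
       indep_vars (\<lambda>_. count_space UNIV) (\<lambda>i \<omega>. N (u (Suc i)) \<omega> - N (u i) \<omega>) {..<n::nat})"

text \<open>The Poisson clock at the site \<open>z\<close> is \<open>clock z\<close>, with value \<open>clock z \<tau> \<omega>\<close> at dynamical
  time \<open>\<tau>\<close>. The initial value at \<open>z\<close> is \<open>val z 0\<close>, and \<open>val z k\<close> for \<open>k > 0\<close> is the fresh value
  drawn at the \<open>k\<close>-th ring. The assumption \<open>indep\<close> says that all the clocks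
  (each one as a whole process) and all the drawn values are jointly independent. It is phrased
  with generated \<open>\<sigma>\<close>-algebras because the two kinds of variables take values in different types.\<close>

locale dynamical_discrete_web = prob_space M
  for M :: "'a measure"
    and clock :: "int \<times> int \<Rightarrow> real \<Rightarrow> 'a \<Rightarrow> nat"
    and val :: "int \<times> int \<Rightarrow> nat \<Rightarrow> 'a \<Rightarrow> int"
    and \<xi> :: "int \<times> int \<Rightarrow> real \<Rightarrow> 'a \<Rightarrow> int" +
  assumes clock: "\<And>z. z \<in> even_lattice \<Longrightarrow> poisson_process 1 (clock z)"
    and val_measurable: "\<And>z k. z \<in> even_lattice \<Longrightarrow> random_variable (count_space UNIV) (val z k)"
    and val_range: "\<And>z k \<omega>. z \<in> even_lattice \<Longrightarrow> \<omega> \<in> space M \<Longrightarrow> val z k \<omega> \<in> {-1, 1}"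
    and val_uniform: "\<And>z k. z \<in> even_lattice \<Longrightarrow>
      distr M (count_space UNIV) (val z k) = measure_pmf (pmf_of_set {-1, 1})"
    and indep: "indep_sets
      (\<lambda>i. case i of
         Inl z \<Rightarrow> sets (vimage_algebra (space M) (\<lambda>\<omega>. \<lambda>\<tau>\<in>{0..}. clock z \<tau> \<omega>)
                         (\<Pi>\<^sub>M \<tau>\<in>{0..}. count_space UNIV))
       | Inr (z, k) \<Rightarrow> sets (vimage_algebra (space M) (val z k) (count_space UNIV)))
      (even_lattice <+> even_lattice \<times> UNIV)"
    and \<xi>_eq: "\<And>z \<tau> \<omega>. z \<in> even_lattice \<Longrightarrow> 0 \<le> \<tau> \<Longrightarrow> \<omega> \<in> space M \<Longrightarrow>
      \<xi> z \<tau> \<omega> = val z (clock z \<tau> \<omega>) \<omega>"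

lemma (in dynamical_discrete_web) \<xi>_right_continuous:
  assumes z: "z \<in> even_lattice" and t: "0 \<le> \<tau>" and w: "\<omega> \<in> space M"
  shows "continuous (at_right \<tau>) (\<lambda>\<sigma>. \<xi> z \<sigma> \<omega>)"
proof -
  have "continuous (at_right \<tau>) (\<lambda>s. clock z s \<omega>)"
    using clock[OF z] t w unfolding poisson_process_def by blast
  then have "\<forall>\<^sub>F s in at_right \<tau>. clock z s \<omega> = clock z \<tau> \<omega>"
    by (simp add: continuous_within tendsto_discrete)
  moreover have "\<forall>\<^sub>F s in at_right \<tau>. \<tau> < s"
    by (rule eventually_at_right_less)
  ultimately have "\<forall>\<^sub>F s in at_right \<tau>. \<xi> z s \<omega> = \<xi> z \<tau> \<omega>"
    by eventually_elim (use z t w \<xi>_eq in auto)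
  then show ?thesis
    by (simp add: continuous_within tendsto_discrete)
qed

text \<open>The path from the origin in an environment of arrows \<open>e\<close>. It visits only sites of
  \<open>even_lattice\<close> when \<open>e\<close> is \<open>{-1, 1}\<close>-valued there.\<close>

primrec lattice_walk :: "(int \<times> int \<Rightarrow> int) \<Rightarrow> nat \<Rightarrow> int"
  where
    "lattice_walk e 0 = 0"
  | "lattice_walk e (Suc n) = lattice_walk e n + e (lattice_walk e n, int n)"

definition web_path :: "(int \<times> int \<Rightarrow> int) \<Rightarrow> real \<Rightarrow> real"
  where "web_path e t = (let n = nat \<lfloor>t\<rfloor> in
    (1 - frac t) * of_int (lattice_walk e n) + frac t * of_int (lattice_walk e (Suc n)))"

definition subdiffusive_plus :: "real \<Rightarrow> (real \<Rightarrow> real) \<Rightarrow> bool"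
  where "subdiffusive_plus K \<pi> \<longleftrightarrow> (\<exists>j\<ge>0. \<forall>t>0. \<pi> t \<ge> - j - K * sqrt t)"

end

theory Submission
  imports Defs
begin

text \<open>
  At a fixed dynamical time the path from the origin is a simple random walk, which almost surely
  violates every barrier \<open>- j - K * sqrt t\<close>. Exceptional times are produced by the second moment method, applied to
  an event that factorises over time scales.

  \<^bold>\<open>The event.\<close> Time is cut into strips, the \<open>k\<close>-th one of length \<open>16 ^ (k + 1)\<close>. In each strip a
  fresh path of the web is started from a deterministic point, and it is required to lose at most
  height \<open>2 * 4 ^ (k + 1)\<close> during the strip, which has probability at least \<open>3 / 4\<close>. The points are
  placed such that the path of strip \<open>k\<close> ends above the starting point of strip \<open>k + 1\<close>. Since paths
  in one environment do not cross, the path from the origin then lies above all of them, hence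
  above a curve \<open>- 8 - 11 * sqrt t\<close> (\<open>strips_imp_curve\<close>). The strips use disjoint sets of arrows, so
  probabilities multiply, for one dynamical time and for two of them.

  \<^bold>\<open>Decorrelation.\<close> Let \<open>d\<close> be the distance of two dynamical times. Two paths run at these times feel
  their common arrows only at steps where they occupy the same site, and there they separate with
  probability of order \<open>d\<close>. Meetings after \<open>t\<close> steps therefore have probability at most of order
  \<open>1 / (d * sqrt t)\<close> (\<open>meet_prob_zero_le\<close>), and a meeting with \<open>m\<close> steps to go contributes to the
  covariance only the squared gradient of the survival probability, of order \<open>1 / m\<close>
  (\<open>half_surv_gradient_sq\<close>). So strip \<open>k\<close> is decorrelated up to a factor \<open>1 + O(1 / (d * 2 ^ k))\<close>
  (\<open>strip_pair_decorrelation\<close>). On the first \<open>log 2 (1 / d)\<close> strips the trivial factor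
  \<open>4 / 3 \<le> sqrt 2\<close> is used, and altogether the joint probability is at most the product of the two
  probabilities times a constant over \<open>sqrt d\<close> (\<open>prod_strip_pair_prob_le\<close>). This is integrable in
  \<open>d\<close>, so the second moment method, on a fine grid of times, bounds the probability that the first
  \<open>N\<close> strips are good at some rational time in \<open>[0, 1]\<close> from below, uniformly in \<open>N\<close>
  (\<open>prob_exists_strip_event\<close>).

  \<^bold>\<open>Passing to the limit.\<close> Times that are good for longer and longer accumulate at some \<open>\<tau>\<close>. As the
  environment is right-continuous with left limits, \<open>\<tau>\<close> is good forever unless the approximation is
  from the left and some clock rings at \<open>\<tau>\<close>. The environment just before a ring of a given clock is
  an environment of independent uniform arrows, so this bad event is null because a random walk
  violates the barrier (\<open>surv_curve_small\<close>, \<open>bad_ring_event_null\<close>). Thus the set of outcomes with an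
  exceptional time agrees up to a null set with an event that involves rational times only; this
  makes it measurable for the completion and gives it positive probability.

  All probabilities are expressed by deterministic recursions over the number of steps, which are
  estimated by elementary means.
\<close>

section \<open>Meetings of two partially correlated walks\<close>

text \<open>Half the gap of two walks that take independent steps when apart, and steps of correlation \<open>\<rho>\<close>
  when they sit on the same site, is a Markov chain. This is its transition operator; the chain is
  sticky at \<open>0\<close>, and for \<open>\<rho> = 0\<close> it is the lazy simple random walk.\<close>

definition gap_step :: "real \<Rightarrow> (int \<Rightarrow> real) \<Rightarrow> int \<Rightarrow> real"
  where "gap_step \<rho> f i =
    (if i = 0 then (1 + \<rho>) / 2 * f 0 + (1 - \<rho>) / 4 * (f 1 + f (- 1))
     else f i / 2 + (f (i + 1) + f (i - 1)) / 4)"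

text \<open>The probability that the gap chain from \<open>i\<close> is at \<open>0\<close> after \<open>t\<close> steps.\<close>

primrec meet_prob :: "real \<Rightarrow> nat \<Rightarrow> int \<Rightarrow> real"
  where
    "meet_prob \<rho> 0 i = of_bool (i = 0)"
  | "meet_prob \<rho> (Suc t) i = gap_step \<rho> (meet_prob \<rho> t) i"

lemma gap_step_mono:
  assumes "0 \<le> \<rho>" "\<rho> \<le> 1" "\<And>i. f i \<le> g i"
  shows "gap_step \<rho> f i \<le> gap_step \<rho> g i"
  using assms(1,2) assms(3)[of i] assms(3)[of 0] assms(3)[of 1] assms(3)[of "-1"]
    assms(3)[of "i+1"] assms(3)[of "i-1"]
  unfolding gap_step_def
  by (auto intro!: add_mono mult_left_mono divide_right_mono)

lemma gap_step_sum:
  "gap_step \<rho> (\<lambda>i. \<Sum>t\<in>A. c t * f t i) i = (\<Sum>t\<in>A. c t * gap_step \<rho> (f t) i)"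
  unfolding gap_step_def
  by (cases "i = 0")
    (simp_all add: sum.distrib [symmetric] sum_distrib_left sum_divide_distrib field_simps)

text \<open>The chain is lazy away from \<open>0\<close>, and \<open>0\<close> holds at least as much as any other state. Hence its
  operator preserves symmetric unimodal functions. Unimodality is what turns the bound on the
  number of meetings, obtained below by summation, into a bound at each single time.\<close>

lemma meet_prob_shape:
  assumes "0 \<le> \<rho>" "\<rho> \<le> 1"
  shows "(\<forall>i. 0 \<le> meet_prob \<rho> t i) \<and> (\<forall>i. meet_prob \<rho> t (- i) = meet_prob \<rho> t i) \<and>
    (\<forall>i\<ge>0. meet_prob \<rho> t (i + 1) \<le> meet_prob \<rho> t i)"
proof (induction t)
  case 0
  show ?case by auto
next
  case (Suc t)
  define f where "f = meet_prob \<rho> t"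
  have nn: "0 \<le> f i" and sym: "f (- i) = f i" for i
    using Suc by (auto simp: f_def)
  have dec: "f (i + 1) \<le> f i" if "0 \<le> i" for i
    using Suc that by (auto simp: f_def)
  have "0 \<le> gap_step \<rho> f i" for i
    using nn assms by (auto simp: gap_step_def)
  moreover have "gap_step \<rho> f (- i) = gap_step \<rho> f i" for i
    using sym[of i] sym[of "i+1"] sym[of "i-1"] by (auto simp: gap_step_def)
  moreover have "gap_step \<rho> f (i + 1) \<le> gap_step \<rho> f i" if i: "0 \<le> i" for i
  proof (cases "i = 0")
    case True
    have "0 \<le> \<rho> / 2 * (f 0 - f 1) + (f 0 - f 2) / 4"
      using dec[of 0] dec[of 1] assms by (auto intro!: add_nonneg_nonneg mult_nonneg_nonneg)
    then show ?thesis
      using True sym[of 1] dec[of 0] dec[of 1]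
      by (simp add: gap_step_def field_simps)
  next
    case False
    then have "f (i + 1) \<le> f i" "f (i + 1 + 1) \<le> f (i + 1)" "f (i - 1 + 1) \<le> f (i - 1)"
      using i by (intro dec; simp)+
    then show ?thesis
      using False i by (simp add: gap_step_def field_simps)
  qed
  ultimately show ?case
    by (simp add: f_def)
qed

lemma meet_prob_nonneg: "0 \<le> \<rho> \<Longrightarrow> \<rho> \<le> 1 \<Longrightarrow> 0 \<le> meet_prob \<rho> t i"
  using meet_prob_shape by blast

lemma meet_prob_le_zero:
  assumes "0 \<le> \<rho>" "\<rho> \<le> 1"
  shows "meet_prob \<rho> t i \<le> meet_prob \<rho> t 0"
proof -
  have *: "meet_prob \<rho> t (int n) \<le> meet_prob \<rho> t 0" for n
  proof (induction n)
    case (Suc n)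
    have "meet_prob \<rho> t (int n + 1) \<le> meet_prob \<rho> t (int n)"
      using meet_prob_shape[OF assms] by auto
    with Suc show ?case by (simp add: add.commute)
  qed simp
  show ?thesis
    using *[of "nat i"] *[of "nat (- i)"] meet_prob_shape[OF assms, of t]
    by (cases "0 \<le> i") auto
qed

lemma meet_prob_zero_antimono:
  assumes "0 \<le> \<rho>" "\<rho> \<le> 1" "s \<le> t"
  shows "meet_prob \<rho> t 0 \<le> meet_prob \<rho> s 0"
  using assms(3)
proof (induction t rule: dec_induct)
  case (step t)
  have "meet_prob \<rho> (Suc t) 0 \<le> gap_step \<rho> (\<lambda>_. meet_prob \<rho> t 0) 0"
    using gap_step_mono[OF assms(1,2) meet_prob_le_zero[OF assms(1,2)]] by simp
  also have "\<dots> = meet_prob \<rho> t 0"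
    by (simp add: gap_step_def field_simps)
  finally show ?case using step by linarith
qed simp

text \<open>The drift of \<open>\<bar>i\<bar>\<close> counts the visits to \<open>0\<close>, up to the factor \<open>(1 - \<rho>) / 2\<close>, and \<open>\<bar>i\<bar>\<close> is
  dominated by the parabola \<open>i\<^sup>2 / (2 * l) + l / 2\<close>, whose drift is at most \<open>1 / (4 * l)\<close>. So
  the right-hand side is a supersolution of the recursion for the expected number of visits; the
  parameter \<open>l\<close> is optimised afterwards.\<close>

lemma sum_meet_prob_le:
  assumes "0 \<le> \<rho>" "\<rho> < 1" "0 < l"
  shows "(\<Sum>s<t. meet_prob \<rho> s i)
    \<le> 2 / (1 - \<rho>) * (((real_of_int i)^2 + t / 2) / (2 * l) + l / 2 - \<bar>real_of_int i\<bar>)"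
proof (induction t arbitrary: i)
  case 0
  have "\<bar>real_of_int i\<bar> \<le> (real_of_int i)\<^sup>2 / (2 * l) + l / 2"
  proof -
    have "0 \<le> (\<bar>real_of_int i\<bar> - l)\<^sup>2" by simp
    then have "2 * l * \<bar>real_of_int i\<bar> \<le> (real_of_int i)\<^sup>2 + l\<^sup>2"
      by (simp add: power2_diff algebra_simps)
    then show ?thesis using assms by (simp add: field_simps power2_eq_square)
  qed
  then show ?case using assms by simp
next
  case (Suc t)
  define \<phi> where "\<phi> i = 2 / (1 - \<rho>) * (((real_of_int i)^2 + t / 2) / (2 * l) + l / 2 - \<bar>real_of_int i\<bar>)" for i
  have "(\<Sum>s<Suc t. meet_prob \<rho> s i) = of_bool (i = 0) + (\<Sum>s<t. meet_prob \<rho> (Suc s) i)"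
    by (subst sum.lessThan_Suc_shift) simp
  also have "(\<Sum>s<t. meet_prob \<rho> (Suc s) i) = gap_step \<rho> (\<lambda>i. \<Sum>s<t. meet_prob \<rho> s i) i"
    using gap_step_sum[where A = "{..<t}" and c = "\<lambda>_. 1" and f = "meet_prob \<rho>"] by simp
  also have "\<dots> \<le> gap_step \<rho> \<phi> i"
    using assms Suc by (intro gap_step_mono) (auto simp: \<phi>_def)
  also have "of_bool (i = 0) + gap_step \<rho> \<phi> i
      \<le> 2 / (1 - \<rho>) * (((real_of_int i)^2 + Suc t / 2) / (2 * l) + l / 2 - \<bar>real_of_int i\<bar>)"
  proof (cases "i = 0")
    case True
    have "1 + gap_step \<rho> \<phi> 0 = 2 / (1 - \<rho>) * (((1 - \<rho>) / 2 + t / 2) / (2 * l) + l / 2)"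
      using assms unfolding gap_step_def \<phi>_def by (simp add: divide_simps) (simp add: algebra_simps)
    also have "\<dots> \<le> 2 / (1 - \<rho>) * ((Suc t / 2) / (2 * l) + l / 2)"
      using assms by (intro mult_left_mono add_mono divide_right_mono) (auto simp: field_simps)
    finally show ?thesis using True by simp
  next
    case False
    have ab: "\<bar>real_of_int (i + 1)\<bar> + \<bar>real_of_int (i - 1)\<bar> = 2 * \<bar>real_of_int i\<bar>"
      using False by (cases "i > 0") auto
    have "gap_step \<rho> \<phi> i = 2 / (1 - \<rho>) * (((real_of_int i)\<^sup>2 / 2 + ((real_of_int (i+1))\<^sup>2
        + (real_of_int (i-1))\<^sup>2) / 4 + t / 2) / (2 * l)
        + l / 2 - (\<bar>real_of_int i\<bar> / 2 + (\<bar>real_of_int (i + 1)\<bar> + \<bar>real_of_int (i - 1)\<bar>) / 4))"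
      using False assms unfolding gap_step_def \<phi>_def by (simp add: divide_simps) (simp add: algebra_simps)
    also have "(real_of_int i)\<^sup>2 / 2 + ((real_of_int (i+1))\<^sup>2 + (real_of_int (i-1))\<^sup>2) / 4 + t / 2
        = (real_of_int i)\<^sup>2 + Suc t / 2"
      by (simp add: power2_eq_square field_simps)
    also have "\<bar>real_of_int i\<bar> / 2 + (\<bar>real_of_int (i + 1)\<bar> + \<bar>real_of_int (i - 1)\<bar>) / 4 = \<bar>real_of_int i\<bar>"
      unfolding ab by simp
    finally show ?thesis using False by simp
  qed
  finally show ?case by simp
qed

lemma meet_prob_zero_le:
  assumes "0 \<le> \<rho>" "\<rho> < 1"
  shows "meet_prob \<rho> t 0 \<le> 3 / (2 * (1 - \<rho>) * sqrt (Suc t))"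
proof -
  let ?l = "sqrt (Suc t)"
  have l: "?l > 0" "?l * ?l = Suc t" by auto
  \<comment> \<open>The last term of an antimonotone sequence is at most the average; \<open>?l\<close> is the optimal parabola.\<close>
  have "?l * ?l * meet_prob \<rho> t 0 = (\<Sum>s<Suc t. meet_prob \<rho> t 0)"
    by (simp add: l)
  also have "\<dots> \<le> (\<Sum>s<Suc t. meet_prob \<rho> s 0)"
    using assms by (intro sum_mono meet_prob_zero_antimono) auto
  also have "\<dots> \<le> 2 / (1 - \<rho>) * ((real (Suc t) / 2) / (2 * ?l) + ?l / 2)"
    using sum_meet_prob_le[OF assms l(1), of 0 "Suc t"] by (simp only: of_int_0) simp
  also have "\<dots> = 2 / (1 - \<rho>) * (?l / 4 + ?l / 2)"
  proof -
    have "a / 2 / (2 * sqrt a) = sqrt a / 4" if "a > 0" for a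
      using that real_div_sqrt[of a] by (simp add: field_simps)
    from this[of "real (Suc t)"] have "real (Suc t) / 2 / (2 * ?l) = ?l / 4"
      by linarith
    then show ?thesis by (simp only:)
  qed
  also have "\<dots> = ?l * (3 / (2 * (1 - \<rho>)))"
    using assms by (simp add: field_simps)
  finally have "?l * meet_prob \<rho> t 0 \<le> 3 / (2 * (1 - \<rho>))"
    using l(1) by (metis mult.assoc mult_le_cancel_left_pos)
  then show ?thesis
    using l(1) assms by (simp add: field_simps)
qed

section \<open>Survival of a walk above a barrier\<close>

primrec srw_prob :: "nat \<Rightarrow> int \<Rightarrow> real"
  where
    "srw_prob 0 x = of_bool (x = 0)"
  | "srw_prob (Suc m) x = (srw_prob m (x + 1) + srw_prob m (x - 1)) / 2"

lemma srw_prob_sym: "srw_prob m (- x) = srw_prob m x"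
proof (induction m arbitrary: x)
  case (Suc m)
  show ?case using Suc[of "x + 1"] Suc[of "x - 1"] by simp
qed simp

lemma srw_prob_odd: "odd (x + int m) \<Longrightarrow> srw_prob m x = 0"
  by (induction m arbitrary: x) auto

text \<open>Two steps of the simple random walk make one step of the lazy walk, so the bound for meetings
  at \<open>\<rho> = 0\<close> is also the local limit bound for the simple random walk.\<close>

lemma srw_prob_even: "srw_prob (2 * t) (2 * i) = meet_prob 0 t i"
proof (induction t arbitrary: i)
  case (Suc t)
  have "srw_prob (2 * Suc t) (2 * i)
      = (srw_prob (2 * t) (2 * i) * 2 + srw_prob (2 * t) (2 * (i + 1)) + srw_prob (2 * t) (2 * (i - 1))) / 4"
    by (simp add: distrib_left right_diff_distrib) (simp add: field_simps)
  then show ?case unfolding Suc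
    by (cases "i = 0") (simp_all add: gap_step_def add_divide_distrib)
qed auto

lemma srw_prob_le: "srw_prob m x \<le> 3 / sqrt (m + 1)"
proof -
  have ev: "srw_prob (2 * t) x \<le> 3 / (2 * sqrt (Suc t))" for t x
  proof (cases "even x")
    case True
    then obtain i where "x = 2 * i" by blast
    then show ?thesis
      using meet_prob_le_zero[of 0 t i] meet_prob_zero_le[of 0 t] by (simp only: srw_prob_even) simp
  next
    case False
    then show ?thesis by (simp add: srw_prob_odd)
  qed
  have *: "srw_prob m x \<le> 3 / (2 * sqrt (Suc (m div 2)))"
  proof (cases "even m")
    case True
    then show ?thesis using ev[of "m div 2" x] by simp
  next
    case False
    then obtain t where t: "m = Suc (2 * t)" by (auto elim: oddE)
    then show ?thesis using ev[of t "x+1"] ev[of t "x-1"] by simp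
  qed
  have "m + 1 \<le> 4 * Suc (m div 2)" by presburger
  then have "sqrt (m + 1) \<le> sqrt (4 * Suc (m div 2))"
    by (metis of_nat_le_iff real_sqrt_le_iff)
  also have "\<dots> = 2 * sqrt (Suc (m div 2))"
    using real_sqrt_mult[of 4 "real (Suc (m div 2))"] by simp
  finally show ?thesis
    by (intro order.trans[OF *] divide_left_mono) auto
qed

text \<open>The probability that a simple random walk from \<open>x\<close> is nonnegative at the times \<open>0, ..., m\<close>.\<close>

primrec half_surv :: "nat \<Rightarrow> int \<Rightarrow> real"
  where
    "half_surv 0 x = of_bool (0 \<le> x)"
  | "half_surv (Suc m) x = (if 0 \<le> x then (half_surv m (x + 1) + half_surv m (x - 1)) / 2 else 0)"

lemma half_surv_neg: "x < 0 \<Longrightarrow> half_surv m x = 0"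
  by (cases m) auto

lemma half_surv_bounds: "0 \<le> half_surv m x \<and> half_surv m x \<le> 1"
proof (induction m arbitrary: x)
  case (Suc m)
  show ?case using Suc[of "x+1"] Suc[of "x-1"] by auto
qed auto

lemmas half_surv_nonneg = half_surv_bounds[THEN conjunct1]
  and half_surv_le_1 = half_surv_bounds[THEN conjunct2]

lemma half_surv_mono: "x \<le> y \<Longrightarrow> half_surv m x \<le> half_surv m y"
proof (induction m arbitrary: x y)
  case (Suc m)
  show ?case using Suc.IH[of "x+1" "y+1"] Suc.IH[of "x-1" "y-1"] Suc.prems half_surv_nonneg
    by auto
qed auto

lemma half_surv_antimono: "m \<le> n \<Longrightarrow> half_surv n x \<le> half_surv m x"
proof (induction n rule: dec_induct)
  case (step n)
  have "half_surv (Suc n) x \<le> half_surv n x" for x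
  proof (induction n arbitrary: x)
    case (Suc n)
    show ?case using Suc[of "x+1"] Suc[of "x-1"] by (auto simp: add_divide_distrib split: if_splits)
  qed auto
  with step show ?case by (meson order.trans)
qed simp

text \<open>A maximal inequality: \<open>(m + (x - L)\<^sup>2) / (L + 1)\<^sup>2\<close> solves the same recursion as the
  probability of leaving the half-line, and it is at least \<open>1\<close> for \<open>x < 0\<close>. It is used at \<open>x = L\<close>.\<close>

lemma half_surv_ge:
  "0 \<le> L \<Longrightarrow> half_surv m x \<ge> 1 - (m + (real_of_int x - L)\<^sup>2) / (L + 1)\<^sup>2" for L :: real
proof (induction m arbitrary: x)
  case 0
  show ?case
  proof (cases "x < 0")
    case True
    then have "real_of_int x \<le> -1" by linarith
    then have "(L + 1)\<^sup>2 \<le> (L - x)\<^sup>2" using 0 by (intro power_mono) auto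
    then show ?thesis using True 0 by (simp add: power2_commute)
  qed auto
next
  case (Suc m)
  show ?case
  proof (cases "x < 0")
    case True
    then have "real_of_int x \<le> -1" by linarith
    then have "(L + 1)\<^sup>2 \<le> (L - x)\<^sup>2" using Suc.prems by (intro power_mono) auto
    then have "(L + 1)\<^sup>2 \<le> real (Suc m) + (x - L)\<^sup>2" by (simp add: power2_commute)
    then show ?thesis using True Suc.prems by simp
  next
    case False
    have "1 - (Suc m + (real_of_int x - L)\<^sup>2) / (L + 1)\<^sup>2
       = ((1 - (m + (real_of_int (x+1) - L)\<^sup>2) / (L + 1)\<^sup>2) + (1 - (m + (real_of_int (x-1) - L)\<^sup>2) / (L
           + 1)\<^sup>2)) / 2"
      using Suc.prems by (simp add: divide_simps) (simp add: power2_eq_square algebra_simps)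
    then show ?thesis using Suc.IH[of "x+1"] Suc.IH[of "x-1"] Suc.prems False by simp
  qed
qed

text \<open>The odd extension of \<open>half_surv m\<close> about \<open>-1\<close> solves the recursion on the whole line. Its increments
  over two sites start as \<open>1, 2, 1\<close> around \<open>-1\<close>, and thus evolve into the same combination of
  transition probabilities. The value at \<open>0\<close> carries the boundary condition through the
  induction.\<close>

lemma half_surv_reflection:
  "half_surv m 0 = srw_prob m 0 + srw_prob m 1 \<and>
   (\<forall>x\<ge>0. half_surv m (x + 1) - half_surv m (x - 1)
      = srw_prob m x + 2 * srw_prob m (x + 1) + srw_prob m (x + 2))"
proof (induction m)
  case 0
  show ?case by auto
next
  case (Suc m)
  have z: "half_surv m 0 = srw_prob m 0 + srw_prob m 1" using Suc by blast
  have g: "half_surv m (x + 1) - half_surv m (x - 1)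
      = srw_prob m x + 2 * srw_prob m (x + 1) + srw_prob m (x + 2)" if "0 \<le> x" for x
    using Suc that by blast
  have m1: "srw_prob m (- 1) = srw_prob m 1" by (rule srw_prob_sym)
  have "half_surv (Suc m) 0 = srw_prob (Suc m) 0 + srw_prob (Suc m) 1"
    using g[of 0] m1 by (simp add: half_surv_neg)
  moreover have "half_surv (Suc m) (x + 1) - half_surv (Suc m) (x - 1)
      = srw_prob (Suc m) x + 2 * srw_prob (Suc m) (x + 1) + srw_prob (Suc m) (x + 2)" if "0 \<le> x" for x
  proof (cases "x = 0")
    case True
    show ?thesis using True g[of 1] z m1 by (simp add: half_surv_neg add_divide_distrib)
  next
    case False
    then show ?thesis using g[of "x+1"] g[of "x-1"] that
      by (simp add: add_divide_distrib add_ac diff_add_eq [symmetric])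
  qed
  ultimately show ?case by blast
qed

lemma half_surv_gradient_sq:
  assumes "0 \<le> x"
  shows "(half_surv m (x + 1) - half_surv m (x - 1))\<^sup>2 / 4 \<le> 36 / (m + 1)"
proof -
  have "half_surv m (x + 1) - half_surv m (x - 1) \<le> 12 / sqrt (m + 1)"
    using half_surv_reflection[of m] assms srw_prob_le[of m x] srw_prob_le[of m "x+1"] srw_prob_le[of m "x+2"]
    by auto
  moreover have "0 \<le> half_surv m (x + 1) - half_surv m (x - 1)"
    using half_surv_mono[of "x-1" "x+1" m] by simp
  ultimately have "(half_surv m (x + 1) - half_surv m (x - 1))\<^sup>2 \<le> (12 / sqrt (m + 1))\<^sup>2"
    by (rule power_mono)
  then show ?thesis by (simp add: power_divide add.commute)
qed

lemma half_surv_le: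
  assumes "-1 \<le> x"
  shows "half_surv m x \<le> 12 * (x + 1) / sqrt (m + 1)"
proof -
  have *: "half_surv m (int n - 1) \<le> 12 * n / sqrt (m + 1)" for n
  proof (induction n rule: induct_nat_012)
    case 0
    show ?case by (simp add: half_surv_neg)
  next
    case 1
    show ?case using half_surv_reflection[of m] srw_prob_le[of m 0] srw_prob_le[of m 1]
      by (simp add: field_simps)
  next
    case (ge2 n)
    have "half_surv m (int n + 1) - half_surv m (int n - 1) \<le> 12 / sqrt (m + 1)"
      using half_surv_reflection[of m] srw_prob_le[of m "int n"] srw_prob_le[of m "int n+1"]
          srw_prob_le[of m "int n+2"]
      by auto
    also have "\<dots> \<le> 24 / sqrt (m + 1)" by (simp add: divide_right_mono)
    finally show ?case using ge2(1) by (simp add: add_divide_distrib algebra_simps)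
  qed
  show ?thesis using *[of "nat (x + 1)"] assms by (simp add: add.commute)
qed

text \<open>By the strong Markov property: to fall by \<open>x + y + 2\<close> it suffices to fall by
  \<open>x + 1\<close> and then, in the remaining time, by another \<open>y + 1\<close>.\<close>

lemma hit_supermult:
  "(1 - half_surv m x) * (1 - half_surv n y) \<le> 1 - half_surv (m + n) (x + y + 1)"
proof (induction m arbitrary: x)
  case 0
  show ?case
    using half_surv_mono[of "x + y + 1" y n] half_surv_le_1[of n] by auto
next
  case (Suc m)
  show ?case
  proof (cases "x < 0")
    case True
    have "half_surv (Suc m + n) (x + y + 1) \<le> half_surv n (x + y + 1)"
      by (rule half_surv_antimono) simp
    also have "\<dots> \<le> half_surv n y"
      using True by (intro half_surv_mono) simp
    finally show ?thesis using True by simp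
  next
    case x: False
    show ?thesis
    proof (cases "x + y + 1 < 0")
      case True
      have "(1 - half_surv (Suc m) x) * (1 - half_surv n y) \<le> 1 * 1"
        by (intro mult_mono) (use half_surv_bounds in auto)
      then show ?thesis using True by (simp add: half_surv_neg del: half_surv.simps)
    next
      case False
      then show ?thesis
        using x Suc.IH[of "x+1"] Suc.IH[of "x-1"]
        by (simp add: add_ac diff_add_eq [symmetric]) (simp add: field_simps)
    qed
  qed
qed

lemma hit_power:
  assumes "0 < L"
  shows "(1 - half_surv m (y - 1)) ^ L \<le> 1 - half_surv (L * m) (int L * y - 1)"
  using assms
proof (induction L rule: nat_induct_non_zero)
  case (Suc L)
  have "(1 - half_surv m (y - 1)) ^ Suc L
      \<le> (1 - half_surv m (y - 1)) * (1 - half_surv (L * m) (int L * y - 1))"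
    using Suc half_surv_le_1 by (simp add: mult_left_mono)
  also have "\<dots> \<le> 1 - half_surv (m + L * m) (y - 1 + (int L * y - 1) + 1)"
    by (rule hit_supermult)
  finally show ?case by (simp add: algebra_simps)
qed simp

section \<open>Two walks in correlated environments\<close>

text \<open>The barrier \<open>c\<close> depends on time. The walk is at \<open>x\<close> at time \<open>t\<close> and has to respect the barrier for
  \<open>m\<close> further steps.\<close>

primrec surv :: "(nat \<Rightarrow> int) \<Rightarrow> nat \<Rightarrow> nat \<Rightarrow> int \<Rightarrow> real"
  where
    "surv c 0 t x = of_bool (c t \<le> x)"
  | "surv c (Suc m) t x =
      (if c t \<le> x then (surv c m (Suc t) (x + 1) + surv c m (Suc t) (x - 1)) / 2 else 0)"

text \<open>Joint survival of two walks from \<open>x\<close> and \<open>y\<close> whose steps have correlation \<open>\<rho>\<close> on a common site and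
  are independent otherwise.\<close>

primrec pair_surv :: "real \<Rightarrow> (nat \<Rightarrow> int) \<Rightarrow> nat \<Rightarrow> nat \<Rightarrow> int \<Rightarrow> int \<Rightarrow> real"
  where
    "pair_surv \<rho> c 0 t x y = of_bool (c t \<le> x \<and> c t \<le> y)"
  | "pair_surv \<rho> c (Suc m) t x y =
      (if c t \<le> x \<and> c t \<le> y then
         if x = y then
           (1 + \<rho>) / 4 * (pair_surv \<rho> c m (Suc t) (x + 1) (x + 1) + pair_surv \<rho> c m (Suc t) (x - 1) (x - 1)) +
           (1 - \<rho>) / 4 * (pair_surv \<rho> c m (Suc t) (x + 1) (x - 1) + pair_surv \<rho> c m (Suc t) (x - 1) (x + 1))
         else
           (pair_surv \<rho> c m (Suc t) (x + 1) (y + 1) + pair_surv \<rho> c m (Suc t) (x - 1) (y - 1) +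
            pair_surv \<rho> c m (Suc t) (x + 1) (y - 1) + pair_surv \<rho> c m (Suc t) (x - 1) (y + 1)) / 4
       else 0)"

lemma surv_const: "surv (\<lambda>_. b) m t x = half_surv m (x - b)"
  by (induction m arbitrary: t x) (auto simp: algebra_simps)

lemma surv_bounds: "0 \<le> surv c m t x \<and> surv c m t x \<le> 1"
proof (induction m arbitrary: t x)
  case (Suc m)
  show ?case using Suc[of "Suc t" "x+1"] Suc[of "Suc t" "x-1"] by auto
qed auto

lemma pair_surv_diag: "pair_surv 1 c m t x x = surv c m t x"
  by (induction m arbitrary: t x) auto

lemma pair_surv_nonneg:
  assumes "0 \<le> \<rho>" "\<rho> \<le> 1" shows "0 \<le> pair_surv \<rho> c m t x y"
  using assms by (induction m arbitrary: t x y) auto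

lemma pair_surv_le_surv:
  assumes "0 \<le> \<rho>" "\<rho> \<le> 1"
  shows "pair_surv \<rho> c m t x y \<le> surv c m t x"
proof (induction m arbitrary: t x y)
  case (Suc m)
  show ?case
  proof (cases "c t \<le> x \<and> c t \<le> y")
    case c: True
    show ?thesis
    proof (cases "x = y")
      case True
      have "pair_surv \<rho> c (Suc m) t x y
        \<le> (1 + \<rho>) / 4 * (surv c m (Suc t) (x + 1) + surv c m (Suc t) (x - 1)) +
           (1 - \<rho>) / 4 * (surv c m (Suc t) (x + 1) + surv c m (Suc t) (x - 1))"
        using c True assms by (auto intro!: add_mono mult_left_mono Suc)
      also have "\<dots> = (surv c m (Suc t) (x + 1) + surv c m (Suc t) (x - 1)) / 2"
        by (simp add: field_simps)
      finally show ?thesis using c by simp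
    next
      case False
      then show ?thesis using c Suc[of "Suc t" "x+1" "y+1"] Suc[of "Suc t" "x+1" "y-1"]
          Suc[of "Suc t" "x-1" "y+1"] Suc[of "Suc t" "x-1" "y-1"]
        by (simp add: add_divide_distrib)
    qed
  qed (use surv_bounds[of c "Suc m" t x] in auto)
qed auto

text \<open>The solution of the recursion for the gap chain with source \<open>36 / (m + 1)\<close> at \<open>0\<close>, the
  squared gradient bound of \<open>half_surv_gradient_sq\<close>.\<close>

primrec covariance_bound :: "real \<Rightarrow> nat \<Rightarrow> int \<Rightarrow> real"
  where
    "covariance_bound \<rho> 0 i = 0"
  | "covariance_bound \<rho> (Suc m) i = of_bool (i = 0) * (36 / (m + 1)) + gap_step \<rho> (covariance_bound \<rho> m) i"

lemma covariance_bound_eq: "covariance_bound \<rho> m i = (\<Sum>t<m. 36 / real (m - t) * meet_prob \<rho> t i)"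
proof (induction m arbitrary: i)
  case (Suc m)
  have "(\<Sum>t<Suc m. 36 / real (Suc m - t) * meet_prob \<rho> t i)
      = 36 / (m + 1) * of_bool (i = 0) + (\<Sum>t<m. 36 / real (m - t) * meet_prob \<rho> (Suc t) i)"
    by (subst sum.lessThan_Suc_shift) simp
  also have "(\<Sum>t<m. 36 / real (m - t) * meet_prob \<rho> (Suc t) i)
      = gap_step \<rho> (\<lambda>i. \<Sum>t<m. 36 / real (m - t) * meet_prob \<rho> t i) i"
    by (subst gap_step_sum) simp
  finally show ?case
    by (simp add: Suc[abs_def])
qed simp

lemma covariance_bound_nonneg: "0 \<le> \<rho> \<Longrightarrow> \<rho> \<le> 1 \<Longrightarrow> 0 \<le> covariance_bound \<rho> m i"
  unfolding covariance_bound_eq by (intro sum_nonneg mult_nonneg_nonneg meet_prob_nonneg) auto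

text \<open>The product of the two survival probabilities solves the recursion for joint survival except on the
  diagonal, where the correlated step produces the additional term
  \<open>\<rho> * (h (y + 1) - h (y - 1))\<^sup>2 / 4\<close>. Collecting these terms along the gap chain gives the
  covariance.\<close>

lemma pair_surv_le_prod:
  assumes \<rho>: "0 \<le> \<rho>" "\<rho> \<le> 1"
  shows "pair_surv \<rho> (\<lambda>_. b) m t (y + 2 * i) y
    \<le> half_surv m (y + 2 * i - b) * half_surv m (y - b) + covariance_bound \<rho> m i"
proof (induction m arbitrary: t y i)
  case (Suc m)
  define x where "x = y + 2 * i"
  define P where "P u v = pair_surv \<rho> (\<lambda>_. b) m (Suc t) u v" for u v
  define h where "h u = half_surv m (u - b)" for u
  have IH: "P u v \<le> h u * h v + covariance_bound \<rho> m j" if "u = v + 2 * j" for u v j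
    using Suc[of "Suc t" v j] that by (simp add: P_def h_def)
  have nn: "0 \<le> half_surv (Suc m) (x - b) * half_surv (Suc m) (y - b) + covariance_bound \<rho> (Suc m) i"
    using half_surv_nonneg covariance_bound_nonneg[OF \<rho>] by (auto intro!: add_nonneg_nonneg
        mult_nonneg_nonneg simp del: half_surv.simps covariance_bound.simps)
  have hS: "half_surv (Suc m) (u - b) = (h (u + 1) + h (u - 1)) / 2" if "b \<le> u" for u
    using that by (simp add: h_def algebra_simps)
  have "pair_surv \<rho> (\<lambda>_. b) (Suc m) t x y
    \<le> half_surv (Suc m) (x - b) * half_surv (Suc m) (y - b) + covariance_bound \<rho> (Suc m) i"
  proof (cases "b \<le> x \<and> b \<le> y")
    case False
    then show ?thesis using nn by (auto simp del: half_surv.simps covariance_bound.simps)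
  next
    case c: True
    show ?thesis
    proof (cases "i = 0")
      case True
      then have xy: "x = y" by (simp add: x_def)
      have "pair_surv \<rho> (\<lambda>_. b) (Suc m) t x y
        = (1 + \<rho>) / 4 * (P (y + 1) (y + 1) + P (y - 1) (y - 1)) + (1 - \<rho>) / 4 * (P (y + 1) (y - 1)
            + P (y - 1) (y + 1))"
        using c xy by (simp add: P_def)
      also have "\<dots> \<le> (1 + \<rho>) / 4 * ((h (y + 1) * h (y + 1) + covariance_bound \<rho> m 0)
          + (h (y - 1) * h (y - 1) + covariance_bound \<rho> m 0))
          + (1 - \<rho>) / 4 * ((h (y + 1) * h (y - 1) + covariance_bound \<rho> m 1) + (h (y - 1) * h (y + 1)
              + covariance_bound \<rho> m (- 1)))"
        using \<rho> by (intro add_mono mult_left_mono IH) auto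
      also have "\<dots> = ((h (y + 1) + h (y - 1)) / 2)\<^sup>2 + \<rho> * ((h (y + 1) - h (y - 1))\<^sup>2 / 4)
          + gap_step \<rho> (covariance_bound \<rho> m) 0"
        by (simp add: gap_step_def power2_eq_square field_simps)
      also have "\<rho> * ((h (y + 1) - h (y - 1))\<^sup>2 / 4) \<le> 1 * (36 / (m + 1))"
        using half_surv_gradient_sq[of "y - b" m] c \<rho> unfolding h_def
        by (intro mult_mono) (auto simp: algebra_simps)
      finally show ?thesis
        unfolding xy hS[OF conjunct2[OF c]] covariance_bound.simps True
        by (simp add: power2_eq_square add.commute[of 1] del: pair_surv.simps)
    next
      case False
      then have xy: "x \<noteq> y" by (simp add: x_def)
      have "pair_surv \<rho> (\<lambda>_. b) (Suc m) t x y
        = (P (x + 1) (y + 1) + P (x - 1) (y - 1) + P (x + 1) (y - 1) + P (x - 1) (y + 1)) / 4"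
        using c xy by (simp add: P_def)
      also have "\<dots> \<le> ((h (x + 1) * h (y + 1) + covariance_bound \<rho> m i) + (h (x - 1) * h (y - 1)
          + covariance_bound \<rho> m i)
          + (h (x + 1) * h (y - 1) + covariance_bound \<rho> m (i + 1)) + (h (x - 1) * h (y + 1)
              + covariance_bound \<rho> m (i - 1))) / 4"
        by (intro divide_right_mono add_mono IH) (auto simp: x_def)
      also have "\<dots> = (h (x + 1) + h (x - 1)) / 2 * ((h (y + 1) + h (y - 1)) / 2)
          + gap_step \<rho> (covariance_bound \<rho> m) i"
        using False by (simp add: gap_step_def field_simps)
      finally show ?thesis
        unfolding hS[OF conjunct1[OF c]] hS[OF conjunct2[OF c]] covariance_bound.simps
        using False by (simp del: pair_surv.simps)
    qed
  qed
  then show ?case unfolding x_def .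
qed simp

lemma sum_inverse_sqrt_le: "(\<Sum>t<m. 1 / sqrt (real (Suc t))) \<le> 2 * sqrt (real m)"
proof (induction m)
  case (Suc m)
  have "2 * sqrt (real m) * sqrt (real (Suc m)) \<le> real m + real (Suc m)"
  proof -
    have "0 \<le> (sqrt (real m) - sqrt (real (Suc m)))\<^sup>2" by simp
    then show ?thesis by (simp add: power2_diff)
  qed
  then have "1 / sqrt (Suc m) \<le> 2 * sqrt (Suc m) - 2 * sqrt m"
    by (simp add: field_simps)
  with Suc show ?case by simp
qed simp

lemma sum_inverse_sqrt_dist_le:
  assumes "i < m"
  shows "(\<Sum>j<m. if j = i then 0 else 1 / sqrt \<bar>real i - real j\<bar>) \<le> 4 * sqrt m"
proof -
  let ?f = "\<lambda>j. if j = i then 0 else 1 / sqrt \<bar>real i - real j\<bar>"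
  have split: "{..<m} = {..<i} \<union> insert i {Suc i..<m}" using assms by auto
  have "sum ?f {..<m} = sum ?f {..<i} + sum ?f (insert i {Suc i..<m})"
    unfolding split by (rule sum.union_disjoint) auto
  also have "sum ?f (insert i {Suc i..<m}) = sum ?f {Suc i..<m}"
    by (subst sum.insert) auto
  also have "sum ?f {..<i} = (\<Sum>t<i. 1 / sqrt (real (Suc t)))"
    by (rule sum.reindex_bij_witness[of _ "\<lambda>t. i - Suc t" "\<lambda>j. i - Suc j"]) (auto simp: of_nat_diff)
  also have "sum ?f {Suc i..<m} = (\<Sum>t<m - Suc i. 1 / sqrt (real (Suc t)))"
    by (rule sum.reindex_bij_witness[of _ "\<lambda>t. Suc i + t" "\<lambda>j. j - Suc i"]) (auto simp: of_nat_diff)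
  also have "(\<Sum>t<i. 1 / sqrt (real (Suc t))) + (\<Sum>t<m - Suc i. 1 / sqrt (real (Suc t)))
      \<le> 2 * sqrt (real i) + 2 * sqrt (real (m - Suc i))"
    by (intro add_mono sum_inverse_sqrt_le)
  also have "\<dots> \<le> 2 * sqrt (real m) + 2 * sqrt (real m)"
    using assms by (intro add_mono mult_left_mono) auto
  finally show ?thesis by simp
qed

lemma covariance_bound_zero_le:
  assumes \<rho>: "0 \<le> \<rho>" "\<rho> < 1" and m: "0 < m"
  shows "covariance_bound \<rho> m 0 \<le> 54 / (1 - \<rho>) * ((harm m + 2) / sqrt m)"
proof -
  have "covariance_bound \<rho> m 0 \<le> (\<Sum>t<m. 36 / real (m - t) * (3 / (2 * (1 - \<rho>) * sqrt (Suc t))))"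
    unfolding covariance_bound_eq by (intro sum_mono mult_left_mono meet_prob_zero_le \<rho>) auto
  also have "\<dots> \<le> (\<Sum>t<m. 54 / (1 - \<rho>) * ((sqrt m / real (m - t) + 1 / sqrt (Suc t)) / m))"
  proof (rule sum_mono)
    fix t assume "t \<in> {..<m}"
    then have t: "t < m" by simp
    have s: "sqrt (Suc t) \<le> sqrt m" using t by simp
    have mt: "real (m - t) + real (Suc t) = real (m + 1)" using t by simp
    \<comment> \<open>Partial fractions, with \<open>m\<close> replaced by \<open>(m - t) + Suc t\<close>.\<close>
    have "1 / (real (m - t) * sqrt (Suc t)) * real m
        \<le> 1 / (real (m - t) * sqrt (Suc t)) * (real (m - t) + sqrt (Suc t) * sqrt (Suc t))"
      using t by (intro mult_left_mono) auto
    also have "\<dots> = sqrt (Suc t) / real (m - t) + 1 / sqrt (Suc t)"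
      using t by (simp add: divide_simps del: of_nat_Suc real_sqrt_mult_self)
    also have "\<dots> \<le> sqrt m / real (m - t) + 1 / sqrt (Suc t)"
      by (intro add_mono divide_right_mono s) auto
    finally have "1 / (real (m - t) * sqrt (Suc t)) \<le> (sqrt m / real (m - t) + 1 / sqrt (Suc t)) / m"
      using m by (simp add: pos_le_divide_eq)
    then have "54 / (1 - \<rho>) * (1 / (real (m - t) * sqrt (Suc t)))
        \<le> 54 / (1 - \<rho>) * ((sqrt m / real (m - t) + 1 / sqrt (Suc t)) / m)"
      using \<rho> by (intro mult_left_mono) auto
    moreover have eq: "36 / r * (3 / (2 * d * q)) = 54 / d * (1 / (r * q))" for r d q :: real
      by (cases "r = 0 \<or> d = 0 \<or> q = 0") (auto simp: divide_simps)
    ultimately show "36 / real (m - t) * (3 / (2 * (1 - \<rho>) * sqrt (Suc t)))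
        \<le> 54 / (1 - \<rho>) * ((sqrt m / real (m - t) + 1 / sqrt (Suc t)) / m)"
      by (simp only: eq)
  qed
  also have "\<dots> = 54 / (1 - \<rho>) * ((sqrt m * (\<Sum>t<m. 1 / real (m - t)) + (\<Sum>t<m. 1 / sqrt (Suc t))) / m)"
  proof -
    have "(\<Sum>t<m. sqrt m / real (m - t) + 1 / sqrt (Suc t))
        = sqrt m * (\<Sum>t<m. 1 / real (m - t)) + (\<Sum>t<m. 1 / sqrt (Suc t))"
      by (simp add: sum.distrib sum_distrib_left)
    then show ?thesis
      by (simp only: sum_distrib_left [symmetric] sum_divide_distrib [symmetric])
  qed
  also have "(\<Sum>t<m. 1 / real (m - t)) = harm m"
    unfolding harm_def
    by (rule sum.reindex_bij_witness[of _ "\<lambda>k. m - k" "\<lambda>t. m - t"]) (auto simp: field_simps)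
  also have "54 / (1 - \<rho>) * ((sqrt m * harm m + (\<Sum>t<m. 1 / sqrt (Suc t))) / m)
      \<le> 54 / (1 - \<rho>) * ((sqrt m * harm m + 2 * sqrt m) / m)"
    using \<rho> by (intro mult_left_mono divide_right_mono add_left_mono sum_inverse_sqrt_le) auto
  also have "(sqrt m * harm m + 2 * sqrt m) / m = (harm m + 2) / sqrt m"
    using m by (simp add: real_div_sqrt divide_simps) (simp add: algebra_simps)
  finally show ?thesis .
qed

section \<open>Strips of geometrically growing length\<close>

text \<open>Lengths and widths are related diffusively. Both are even, which keeps the starting points of all
  strips on the even lattice.\<close>

definition strip_length :: "nat \<Rightarrow> nat" where "strip_length k = 16 ^ (k + 1)"
definition strip_width :: "nat \<Rightarrow> int" where "strip_width k = 2 * 4 ^ (k + 1)"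
definition strip_time :: "nat \<Rightarrow> nat" where "strip_time k = (\<Sum>i<k. strip_length i)"
definition strip_pos :: "nat \<Rightarrow> int" where "strip_pos k = - (\<Sum>i<k. strip_width i)"

definition strip_prob :: "nat \<Rightarrow> real"
  where "strip_prob k = half_surv (strip_length k) (strip_width k)"

definition strip_pair_prob :: "real \<Rightarrow> nat \<Rightarrow> real"
  where "strip_pair_prob \<rho> k = pair_surv \<rho> (\<lambda>_. strip_pos (Suc k)) (strip_length k)
    (strip_time k) (strip_pos k) (strip_pos k)"

lemma strip_pos_diff: "strip_pos k - strip_pos (Suc k) = strip_width k"
  by (simp add: strip_pos_def)

lemma strip_prob_ge: "3 / 4 \<le> strip_prob k"
proof -
  define r where "r = (4::real) ^ (k + 1)"
  have r: "1 \<le> r" unfolding r_def by (rule one_le_power) simp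
  have "real (strip_length k) = r\<^sup>2"
    unfolding strip_length_def r_def by (simp add: power_mult_distrib power2_eq_square flip:
        power_mult_distrib)
  moreover have "real_of_int (strip_width k) = 2 * r"
    by (simp add: strip_width_def r_def)
  ultimately have "strip_prob k \<ge> 1 - (r\<^sup>2 + 0) / (2 * r + 1)\<^sup>2"
    using half_surv_ge[of "2 * r" "strip_length k" "strip_width k"] r
    by (simp add: strip_prob_def)
  moreover have "r\<^sup>2 / (2 * r + 1)\<^sup>2 \<le> 1 / 4"
  proof -
    have "4 * r\<^sup>2 \<le> (2 * r + 1)\<^sup>2" using r by (simp add: power2_eq_square algebra_simps)
    then show ?thesis using r by (simp add: divide_simps)
  qed
  ultimately show ?thesis by simp
qed

lemma strip_pair_prob_le: "0 \<le> \<rho> \<Longrightarrow> \<rho> \<le> 1 \<Longrightarrow> strip_pair_prob \<rho> k \<le> strip_prob k"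
  using pair_surv_le_surv[of \<rho> "\<lambda>_. strip_pos (Suc k)" "strip_length k" "strip_time k" "strip_pos k"
      "strip_pos k"]
  by (simp add: strip_pair_prob_def strip_prob_def surv_const strip_pos_diff)

lemma strip_pair_prob_1: "strip_pair_prob 1 k = strip_prob k"
  by (simp add: strip_pair_prob_def strip_prob_def surv_const pair_surv_diag strip_pos_diff)

lemma strip_pair_prob_nonneg: "0 \<le> \<rho> \<Longrightarrow> \<rho> \<le> 1 \<Longrightarrow> 0 \<le> strip_pair_prob \<rho> k"
  by (simp add: strip_pair_prob_def pair_surv_nonneg)

lemma harm_le_ln: "0 < n \<Longrightarrow> harm n \<le> 1 + ln (real n)"
  using decseqD[OF decseq_harm_diff_ln, of 0 "n - 1"] by (simp add: harm_def)

lemma one_minus_exp_ge: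
  assumes "0 \<le> d" "d \<le> (1::real)" shows "d / 2 \<le> 1 - exp (- d)"
proof -
  have "exp (- d) \<le> 1 / (1 + d)"
    using exp_ge_add_one_self[of d] assms by (simp add: exp_minus field_simps)
  also have "\<dots> \<le> 1 - d / 2"
    using assms mult_mono[of d 1 d d] by (simp add: divide_simps) (simp add: algebra_simps)
  finally show ?thesis by simp
qed

text \<open>Sum of the meeting bound of order \<open>1 / (d * sqrt t)\<close> against the gradient bound of order
  \<open>1 / (m - t)\<close> over a strip of length \<open>m = 16 ^ (k + 1)\<close>: this is of order \<open>ln m / (d * sqrt m)\<close>. The
  logarithm is absorbed by passing from \<open>4 ^ k\<close> to \<open>2 ^ k\<close>.\<close>

lemma strip_pair_decorrelation:
  assumes d: "0 < d" "d \<le> 1"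
  shows "strip_pair_prob (exp (- d)) k \<le> (strip_prob k)\<^sup>2 * exp (400 / d / 2 ^ k)"
proof -
  let ?m = "strip_length k" and ?p = "strip_prob k"
  have m: "0 < ?m" "sqrt ?m = 4 ^ (k + 1)"
  proof -
    have "real ?m = (4 ^ (k + 1))\<^sup>2"
      unfolding strip_length_def by (simp add: power2_eq_square flip: power_mult_distrib)
    then show "sqrt ?m = 4 ^ (k + 1)" by (simp del: power_Suc)
  qed (simp add: strip_length_def)
  have "ln (real ?m) = real (k + 1) * (4 * ln 2)"
    using ln_realpow[of "2::real" 4] by (simp add: strip_length_def ln_mult ln_realpow algebra_simps)
  also have "\<dots> \<le> real (k + 1) * (4 * 1)"
    using ln_2_less_1 by (intro mult_left_mono) auto
  finally have "harm ?m + 2 \<le> 7 * real (k + 1)"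
    using harm_le_ln[OF m(1)] by simp
  also have "real (k + 1) \<le> 2 ^ k"
  proof -
    have "k + 1 \<le> 2 ^ k" using less_exp[of k] by linarith
    then show ?thesis by (metis of_nat_le_iff of_nat_numeral of_nat_power)
  qed
  finally have h: "(harm ?m + 2) / sqrt ?m \<le> 7 * 2 ^ k / 4 ^ (k + 1)"
    unfolding m by (simp add: divide_right_mono)
  have "7 * 2 ^ k / 4 ^ (k + 1) = 7 / 4 / (2::real) ^ k"
    by (simp add: divide_simps flip: power_mult_distrib)
  with h have h: "(harm ?m + 2) / sqrt ?m \<le> 7 / 4 / 2 ^ k" by simp
  have e: "54 / (1 - exp (- d)) \<le> 108 / d"
    using one_minus_exp_ge[of d] d by (simp add: divide_simps)
  have "covariance_bound (exp (- d)) ?m 0 \<le> 54 / (1 - exp (- d)) * ((harm ?m + 2) / sqrt ?m)"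
    using d m by (intro covariance_bound_zero_le) auto
  also have "\<dots> \<le> 108 / d * (7 / 4 / 2 ^ k)"
    using d e h by (intro mult_mono) (auto intro!: divide_nonneg_nonneg add_nonneg_nonneg harm_nonneg)
  also have "\<dots> \<le> 200 / d / 2 ^ k"
    using d by (simp add: divide_simps)
  finally have c: "covariance_bound (exp (- d)) ?m 0 \<le> 200 / d / 2 ^ k" .
  have "strip_pair_prob (exp (- d)) k \<le> ?p * ?p + covariance_bound (exp (- d)) ?m 0"
    using pair_surv_le_prod[of "exp (- d)" "strip_pos (Suc k)" ?m "strip_time k" "strip_pos k" 0] d
    by (simp add: strip_pair_prob_def strip_prob_def strip_pos_diff)
  also have "\<dots> \<le> ?p\<^sup>2 + 200 / d / 2 ^ k"
    using c by (simp add: power2_eq_square)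
  also have "200 / d / 2 ^ k \<le> ?p\<^sup>2 * (400 / d / 2 ^ k)"
  proof -
    have "(3/4)\<^sup>2 \<le> ?p\<^sup>2" using strip_prob_ge by (intro power_mono) auto
    then have "1 / 2 * (400 / d / 2 ^ k) \<le> ?p\<^sup>2 * (400 / d / 2 ^ k)"
      using d by (intro mult_right_mono) (auto simp: power2_eq_square)
    then show ?thesis by simp
  qed
  also have "?p\<^sup>2 + ?p\<^sup>2 * (400 / d / 2 ^ k) = ?p\<^sup>2 * (1 + 400 / d / 2 ^ k)"
    by (simp add: algebra_simps)
  also have "\<dots> \<le> ?p\<^sup>2 * exp (400 / d / 2 ^ k)"
    by (intro mult_left_mono exp_ge_add_one_self) auto
  finally show ?thesis by simp
qed

lemma strip_pair_prob_crude:
  assumes "0 \<le> \<rho>" "\<rho> \<le> 1"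
  shows "strip_pair_prob \<rho> k \<le> (strip_prob k)\<^sup>2 * sqrt 2"
proof -
  have "1 \<le> 3 / 4 * sqrt 2"
    by (rule power2_le_imp_le) (auto simp: power_mult_distrib power2_eq_square)
  also have "\<dots> \<le> strip_prob k * sqrt 2"
    using strip_prob_ge by (intro mult_right_mono) auto
  finally have "strip_prob k * 1 \<le> strip_prob k * (strip_prob k * sqrt 2)"
    using strip_prob_ge[of k] by (intro mult_left_mono) auto
  then show ?thesis
    using strip_pair_prob_le[OF assms, of k] by (simp add: power2_eq_square)
qed

text \<open>Decorrelation is useful once \<open>2 ^ k\<close> exceeds \<open>1 / d\<close>; the errors of these strips have a bounded
  sum. On the earlier strips the joint probability exceeds the product at most by the factor \<open>sqrt 2\<close>,
  and \<open>sqrt 2 ^ k0\<close> is of order \<open>1 / sqrt d\<close>. Any success probability above \<open>1 / 2\<close> would give an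
  exponent below \<open>1\<close> here, which is all that the second moment needs.\<close>

lemma prod_strip_pair_prob_le:
  assumes d: "0 < d" "d \<le> 1"
  shows "(\<Prod>k<N. strip_pair_prob (exp (- d)) k)
    \<le> (\<Prod>k<N. strip_prob k)\<^sup>2 * (sqrt 2 * exp 800 / sqrt d)"
proof -
  define k0 where "k0 = nat \<lceil>log 2 (1 / d)\<rceil>"
  have l: "0 \<le> log 2 (1 / d)" using d by simp
  have p: "(2::real) ^ k0 = 2 powr (real k0)" by (simp add: powr_realpow)
  have "real k0 \<ge> log 2 (1 / d)" "real k0 \<le> log 2 (1 / d) + 1"
    using l unfolding k0_def by linarith+
  then have "2 powr (log 2 (1 / d)) \<le> 2 ^ k0" "2 ^ k0 \<le> 2 powr (log 2 (1 / d) + 1)"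
    unfolding p by (auto intro!: powr_mono)
  then have k0: "1 / d \<le> 2 ^ k0" "2 ^ k0 \<le> 2 / d"
    using d by (auto simp: powr_add)
  define a where "a = 400 / d"
  define u where "u k = (if k < k0 then sqrt 2 else 1)" for k
  define v where "v k = (if k < k0 then 0 else a / 2 ^ k)" for k
  have "strip_pair_prob (exp (- d)) k \<le> (strip_prob k)\<^sup>2 * (u k * exp (v k))" for k
    using strip_pair_decorrelation[OF d, of k] strip_pair_prob_crude[of "exp (- d)" k] d
    by (simp add: u_def v_def a_def)
  then have "(\<Prod>k<N. strip_pair_prob (exp (- d)) k) \<le> (\<Prod>k<N. (strip_prob k)\<^sup>2 * (u k * exp (v k)))"
    using d by (intro prod_mono) (auto intro!: strip_pair_prob_nonneg)
  also have "\<dots> = (\<Prod>k<N. strip_prob k)\<^sup>2 * ((\<Prod>k<N. u k) * exp (\<Sum>k<N. v k))"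
    by (simp add: prod.distrib prod_power_distrib exp_sum)
  also have "\<dots> \<le> (\<Prod>k<N. strip_prob k)\<^sup>2 * (sqrt (2 / d) * exp 800)"
  proof (intro mult_left_mono mult_mono)
    have "(\<Prod>k<N. u k) \<le> (\<Prod>k\<in>{..<max N k0}. u k)"
      by (rule prod_mono2) (auto simp: u_def)
    also have "\<dots> = (\<Prod>k<k0. sqrt 2)"
      by (rule prod.mono_neutral_cong_right) (auto simp: u_def)
    also have "\<dots> = sqrt (2 ^ k0)"
      by (simp add: real_sqrt_power)
    also have "\<dots> \<le> sqrt (2 / d)"
      using k0 by simp
    finally show "(\<Prod>k<N. u k) \<le> sqrt (2 / d)" .
    have "(\<Sum>k<N. v k) + 2 * a / 2 ^ (max N k0) = 2 * a / 2 ^ k0"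
    proof (induction N)
      case (Suc N)
      show ?case
      proof (cases "N < k0")
        case True
        then have "max (Suc N) k0 = k0" "max N k0 = k0" "v N = 0" by (auto simp: v_def)
        then show ?thesis using Suc by simp
      next
        case False
        then have *: "max (Suc N) k0 = Suc N" "max N k0 = N" "v N = a / 2 ^ N" by (auto simp: v_def)
        show ?thesis using Suc *(3) unfolding *(1,2) by simp
      qed
    qed simp
    moreover have "0 \<le> 2 * a / 2 ^ (max N k0)" using d by (simp add: a_def)
    moreover have "2 * a / 2 ^ k0 \<le> 800"
      using k0(1) d by (simp add: a_def field_simps)
    ultimately show "exp (\<Sum>k<N. v k) \<le> exp 800" by simp
  qed (use d in \<open>auto intro!: prod_nonneg simp: u_def\<close>)
  also have "sqrt (2 / d) * exp 800 = sqrt 2 * exp 800 / sqrt d"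
    by (simp add: real_sqrt_divide)
  finally show ?thesis .
qed

section \<open>A random walk violates every square root barrier\<close>

definition curve :: "real \<Rightarrow> nat \<Rightarrow> nat \<Rightarrow> int"
  where "curve K j t = \<lceil>- real j - K * sqrt t\<rceil>"

lemma surv_le_half_surv:
  "(\<And>s. t \<le> s \<Longrightarrow> s \<le> t + m \<Longrightarrow> b \<le> c s) \<Longrightarrow> surv c m t x \<le> half_surv m (x - b)"
proof (induction m arbitrary: t x)
  case 0
  then show ?case using "0.prems"[of t] by auto
next
  case (Suc m)
  have "surv c m (Suc t) y \<le> half_surv m (y - b)" for y
    using Suc.prems by (intro Suc.IH) auto
  from this[of "x+1"] this[of "x-1"] show ?case
    using Suc.prems[of t] half_surv_nonneg[of m] by (auto simp: algebra_simps)
qed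

text \<open>The Markov property at time \<open>t + m\<close>, with the worst case over all positions that can be reached.\<close>

lemma surv_add_le:
  assumes "0 \<le> q"
  shows "(\<And>y. y \<le> x + int m \<Longrightarrow> surv c n (t + m) y \<le> q) \<Longrightarrow> surv c (m + n) t x \<le> surv c m t x * q"
proof (induction m arbitrary: t x)
  case 0
  show ?case
  proof (cases "c t \<le> x")
    case True
    then show ?thesis using 0[of x] by simp
  next
    case False
    then have "surv c n t x = 0" by (cases n) auto
    then show ?thesis using assms by simp
  qed
next
  case (Suc m)
  have "surv c (m + n) (Suc t) y \<le> surv c m (Suc t) y * q" if "y \<le> x + 1" for y
    using Suc.prems that by (intro Suc.IH) auto
  from this[of "x+1"] this[of "x-1"] show ?case
    by (auto simp: algebra_simps add_divide_distrib)
qed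

text \<open>Irrespective of the past, the walk crosses the barrier with a fixed probability before a
  sufficiently late time. The required depth is linear in \<open>L * y\<close> and is covered in \<open>L\<close> stages of depth
  \<open>y\<close>, each of duration \<open>m\<close> proportional to \<open>y\<^sup>2\<close> and succeeding with probability at least \<open>1 / 2\<close>.
  In the total time \<open>L * m\<close> the barrier descends only by an amount of order \<open>K * sqrt L * y\<close>, which is
  less than \<open>L * y / 2\<close> for large \<open>L\<close>.\<close>

lemma curve_block:
  assumes "0 < K"
  shows "\<exists>q. 0 \<le> q \<and> q < 1 \<and> (\<forall>t. \<exists>m. \<forall>x\<le>int t. surv (curve K j) m t x \<le> q)"
proof -
  define L where "L = nat \<lceil>(64 * K)\<^sup>2\<rceil>"
  have L: "(64 * K)\<^sup>2 \<le> real L" "0 < L"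
  proof -
    have "0 < (64 * K)\<^sup>2" using assms by simp
    then show "(64 * K)\<^sup>2 \<le> real L" "0 < L" unfolding L_def by linarith+
  qed
  then have KL: "64 * K \<le> sqrt L" using assms by (simp add: real_le_rsqrt)
  have "\<exists>m. \<forall>x\<le>int t. surv (curve K j) m t x \<le> 1 - (1 / 2) ^ L" for t
  proof -
    \<comment> \<open>Half of \<open>L * y\<close> pays for the position at time \<open>t\<close> and the barrier there, the other half for its
      further descent.\<close>
    define y where "y = nat \<lceil>2 * (real t + j + K * sqrt t + 1)\<rceil>"
    have y: "2 * (real t + j + K * sqrt t + 1) \<le> y" "0 < y"
    proof -
      have "0 \<le> K * sqrt t" using assms by simp
      then have "0 < 2 * (real t + j + K * sqrt t + 1)"
        by (intro mult_pos_pos add_nonneg_pos add_nonneg_nonneg) auto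
      then show "2 * (real t + j + K * sqrt t + 1) \<le> y" "0 < y" unfolding y_def by linarith+
    qed
    define m where "m = (32 * y)\<^sup>2"
    have sm: "sqrt (real m) = 32 * y"
      by (simp only: m_def of_nat_power real_sqrt_abs)
    have half: "1 / 2 \<le> 1 - half_surv m (int y - 1)"
    proof -
      have "half_surv m (int y - 1) \<le> 12 * y / sqrt (m + 1)"
        using half_surv_le[of "int y - 1" m] by (simp add: add.commute)
      also have "\<dots> \<le> 12 * y / (32 * real y)"
      proof (intro divide_left_mono)
        have "sqrt (real m) \<le> sqrt (real (m + 1))" by simp
        then show "32 * real y \<le> sqrt (real (m + 1))" using sm by linarith
      qed (use y in auto)
      also have "\<dots> \<le> 1 / 2" using y by simp
      finally show ?thesis by simp
    qed
    let ?b = "curve K j (t + L * m)"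
    have "surv (curve K j) (L * m) t x \<le> 1 - (1 / 2) ^ L" if x: "x \<le> int t" for x
    proof -
      have "?b \<le> curve K j s" if "s \<le> t + L * m" for s
        unfolding curve_def using that assms
        by (intro ceiling_mono diff_left_mono mult_left_mono) (auto simp del: of_nat_add of_nat_mult)
      then have "surv (curve K j) (L * m) t x \<le> half_surv (L * m) (x - ?b)"
        by (intro surv_le_half_surv) auto
      also have "\<dots> \<le> half_surv (L * m) (int L * int y - 1)"
      proof (rule half_surv_mono)
        have "sqrt (real (t + L * m)) \<le> sqrt t + sqrt (real (L * m))"
          by (simp add: sqrt_add_le_add_sqrt)
        also have "sqrt (real (L * m)) = 32 * sqrt L * y"
          by (simp add: sm real_sqrt_mult)
        finally have "K * sqrt (real (t + L * m)) \<le> K * (sqrt t + 32 * sqrt L * y)"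
          using assms by (intro mult_left_mono) auto
        then have "K * sqrt (real (t + L * m)) \<le> K * sqrt t + (32 * K) * sqrt L * y"
          by (simp only: distrib_left mult.assoc mult.left_commute)
        also have "(32 * K) * sqrt L * y \<le> (sqrt L / 2) * sqrt L * y"
          using KL by (intro mult_right_mono) auto
        also have "(sqrt L / 2) * sqrt L * y = real L * y / 2"
          by simp
        finally have "K * sqrt (real (t + L * m)) \<le> K * sqrt t + real L * y / 2"
          by simp
        moreover have "1 * real y \<le> real L * real y"
          using L by (intro mult_right_mono) auto
        moreover have "a + b + k + 1 \<le> v"
          if "2 * (a + b + c + 1) \<le> w" "k \<le> c + v / 2" "1 * w \<le> v" for a b c k v w :: real
          using that by (simp add: field_simps)
        ultimately have "real t + j + K * sqrt (real (t + L * m)) + 1 \<le> real L * y"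
          using y(1) by blast
        moreover have "- real j - K * sqrt (real (t + L * m)) \<le> ?b"
          unfolding curve_def by linarith
        ultimately have "real_of_int (int t - ?b) \<le> real_of_int (int L * int y - 1)"
          by simp
        then show "x - ?b \<le> int L * int y - 1" using x by linarith
      qed
      also have "\<dots> \<le> 1 - (1 / 2) ^ L"
        using hit_power[OF L(2), of m "int y"] power_mono[OF half, of L] by simp
      finally show ?thesis .
    qed
    then show ?thesis by blast
  qed
  then show ?thesis
    by (intro exI[of _ "1 - (1 / 2) ^ L"]) (auto simp: power_le_one)
qed

lemma surv_curve_small:
  assumes "0 < K" "0 < \<epsilon>"
  shows "\<exists>n. surv (curve K j) n 0 0 < \<epsilon>"
proof -
  obtain q where q: "0 \<le> q" "q < 1" "\<And>t. \<exists>m. \<forall>x\<le>int t. surv (curve K j) m t x \<le> q"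
    using curve_block[OF assms(1), of j] by blast
  have "\<exists>n. surv (curve K j) n 0 0 \<le> q ^ i" for i
  proof (induction i)
    case 0
    show ?case using surv_bounds by auto
  next
    case (Suc i)
    then obtain n where n: "surv (curve K j) n 0 0 \<le> q ^ i" by blast
    obtain m where m: "\<And>x. x \<le> int n \<Longrightarrow> surv (curve K j) m n x \<le> q" using q(3)[of n] by blast
    have "surv (curve K j) (n + m) 0 0 \<le> surv (curve K j) n 0 0 * q"
      using q m by (intro surv_add_le) auto
    also have "\<dots> \<le> q ^ i * q" using n q by (intro mult_right_mono)
    finally show ?case by (auto simp: mult.commute)
  qed
  moreover obtain i where "q ^ i < \<epsilon>" using real_arch_pow_inv[OF assms(2) q(2)] by blast
  ultimately show ?thesis by (meson le_less_trans)
qed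

section \<open>Paths of the web above barriers\<close>

text \<open>The path started from \<open>(x, t)\<close> in the environment \<open>e\<close> respects the barrier for \<open>m\<close> steps. The recursion
  reveals the environment level by level, in the order in which the probabilities above are
  computed.\<close>

primrec stays :: "(int \<times> int \<Rightarrow> int) \<Rightarrow> (nat \<Rightarrow> int) \<Rightarrow> nat \<Rightarrow> nat \<Rightarrow> int \<Rightarrow> bool"
  where
    "stays e c 0 t x \<longleftrightarrow> c t \<le> x"
  | "stays e c (Suc m) t x \<longleftrightarrow> c t \<le> x \<and> stays e c m (Suc t) (x + e (x, int t))"

lemma stays_lattice_walk:
  "stays e c m t (lattice_walk e t) \<longleftrightarrow> (\<forall>i\<in>{t..t + m}. c i \<le> lattice_walk e i)"
proof (induction m arbitrary: t)
  case (Suc m)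
  have "{t..t + Suc m} = insert t {Suc t..Suc t + m}" by auto
  then show ?case using Suc[of "Suc t"] by simp
qed simp

definition sign_env :: "(int \<times> int \<Rightarrow> int) \<Rightarrow> bool"
  where "sign_env e \<longleftrightarrow> (\<forall>z\<in>even_lattice. e z \<in> {-1, 1})"

lemma sign_envD: "sign_env e \<Longrightarrow> even (x + t) \<Longrightarrow> e (x, t) = -1 \<or> e (x, t) = 1"
  by (auto simp: sign_env_def even_lattice_def)

lemma even_lattice_walk: "sign_env e \<Longrightarrow> even (lattice_walk e n + int n)"
proof (induction n)
  case (Suc n)
  then show ?case using sign_envD[of e "lattice_walk e n" "int n"] by auto
qed simp

text \<open>Positions of the same parity that differ do so by at least \<open>2\<close>, so one step cannot exchange two paths,
  and after meeting they coincide.\<close>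

lemma stays_noncrossing:
  assumes "sign_env e"
  shows "stays e (\<lambda>_. b) m t x \<Longrightarrow> even (x + int t) \<Longrightarrow> x \<le> lattice_walk e t \<Longrightarrow>
    i \<in> {t..t + m} \<Longrightarrow> b \<le> lattice_walk e i"
proof (induction m arbitrary: t x)
  case 0
  then show ?case by auto
next
  case (Suc m)
  show ?case
  proof (cases "i = t")
    case True
    then show ?thesis using Suc.prems by auto
  next
    case False
    let ?y = "lattice_walk e t"
    have y: "even (?y + int t)" by (rule even_lattice_walk[OF assms])
    note ex = sign_envD[OF assms Suc.prems(2)] and ey = sign_envD[OF assms y]
    show ?thesis
    proof (rule Suc.IH[of "Suc t" "x + e (x, int t)"])
      show "even (x + e (x, int t) + int (Suc t))" using ex Suc.prems(2) by auto
      show "x + e (x, int t) \<le> lattice_walk e (Suc t)"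
      proof (cases "x = ?y")
        case False
        have "even (?y - x)" using y Suc.prems(2) by presburger
        then have "x + 2 \<le> ?y" using False Suc.prems(3) by presburger
        then show ?thesis using ex ey by auto
      qed auto
    qed (use Suc.prems False in auto)
  qed
qed

lemma even_strip: "even (strip_pos k + int (strip_time k))"
  by (simp add: strip_pos_def strip_time_def strip_length_def strip_width_def dvd_sum)

lemma strip_pos_eq: "3 * strip_pos k = 8 - 8 * 4 ^ k"
  by (induction k) (auto simp: strip_pos_def strip_width_def)

lemma strip_time_Suc: "strip_time (Suc k) = strip_time k + strip_length k"
  by (simp add: strip_time_def)

lemma strip_time_ge: "n \<le> strip_time n"
proof (induction n)
  case (Suc n)
  have "0 < strip_length n" by (simp add: strip_length_def)
  with Suc show ?case by (simp add: strip_time_Suc)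
qed simp

text \<open>From the second strip on, \<open>sqrt n\<close> is at least \<open>4 ^ k\<close>, while the floor of the strip is above
  \<open>- 32 / 3 * 4 ^ k\<close>. The first strip, with floor \<open>-8\<close>, fixes the additive constant.\<close>

lemma curve_le_strip_pos:
  assumes "strip_time k \<le> n" "11 \<le> K"
  shows "curve K 8 n \<le> strip_pos (Suc k)"
proof -
  have "- 8 - K * sqrt n \<le> real_of_int (strip_pos (Suc k))"
  proof (cases k)
    case 0
    then show ?thesis using assms by (simp add: strip_pos_def strip_width_def)
  next
    case (Suc l)
    have "16 ^ k \<le> n" using assms(1) Suc by (simp add: strip_time_Suc strip_length_def)
    then have "real (16 ^ k) \<le> real n" by (simp only: of_nat_le_iff)
    then have "((4::real) ^ k)\<^sup>2 \<le> real n" by (simp add: power2_eq_square flip: power_mult_distrib)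
    then have "4 ^ k \<le> sqrt n" by (rule real_le_rsqrt)
    then have "11 * 4 ^ k \<le> K * sqrt n" using assms(2) by (intro mult_mono) auto
    moreover have "3 * real_of_int (strip_pos (Suc k)) = 8 - 32 * 4 ^ k"
      using arg_cong[OF strip_pos_eq[of "Suc k"], of real_of_int] by simp
    moreover have "0 \<le> (4::real) ^ k" by simp
    ultimately show ?thesis by linarith
  qed
  then show ?thesis by (simp add: curve_def ceiling_le_iff)
qed

definition stays_in_strip :: "(int \<times> int \<Rightarrow> int) \<Rightarrow> nat \<Rightarrow> bool"
  where "stays_in_strip e k \<longleftrightarrow>
    stays e (\<lambda>_. strip_pos (Suc k)) (strip_length k) (strip_time k) (strip_pos k)"

lemma strips_imp_curve:
  assumes e: "sign_env e" and K: "11 \<le> K" and s: "\<And>k. k < N \<Longrightarrow> stays_in_strip e k"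
    and n: "n \<le> strip_time N"
  shows "stays e (curve K 8) n 0 0"
proof -
  have start: "strip_pos k \<le> lattice_walk e (strip_time k)" if "k \<le> N" for k
    using that
  proof (induction k)
    case 0
    show ?case by (simp add: strip_pos_def strip_time_def)
  next
    case (Suc k)
    then show ?case
      using stays_noncrossing[OF e, of "strip_pos (Suc k)" "strip_length k" "strip_time k" "strip_pos k"
          "strip_time (Suc k)"]
        s[of k] even_strip[of k] by (auto simp: stays_in_strip_def strip_time_Suc)
  qed
  have below: "curve K 8 i \<le> lattice_walk e i" if "i \<le> strip_time k" "k \<le> N" for i k
    using that
  proof (induction k)
    case 0
    then show ?case by (simp add: strip_time_def curve_def)
  next
    case (Suc k)
    show ?case
    proof (cases "i \<le> strip_time k")
      case False
      then have "strip_pos (Suc k) \<le> lattice_walk e i"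
        using Suc.prems s[of k] start[of k] even_strip[of k]
          stays_noncrossing[OF e, of "strip_pos (Suc k)" "strip_length k" "strip_time k" "strip_pos k" i]
        by (simp add: stays_in_strip_def strip_time_Suc)
      with curve_le_strip_pos[of k i K] False K show ?thesis by linarith
    qed (use Suc in auto)
  qed
  show ?thesis
    using stays_lattice_walk[of e "curve K 8" n 0] below[of _ N] n by auto
qed

lemma stays_antimono: "stays e c n t x \<Longrightarrow> m \<le> n \<Longrightarrow> stays e c m t x"
proof (induction n arbitrary: m t x)
  case (Suc n)
  then show ?case by (cases m) auto
qed auto

text \<open>The interpolated path is at most \<open>1\<close> below its value at the preceding integer time, and the
  additive constant \<open>j\<close> absorbs this.\<close>

lemma subdiffusive_iff_stays:
  assumes e: "sign_env e" and K: "0 \<le> K"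
  shows "subdiffusive_plus K (web_path e) \<longleftrightarrow> (\<exists>j. \<forall>n. stays e (curve K j) n 0 0)"
proof -
  have st: "(\<forall>n. stays e (curve K j) n 0 0) \<longleftrightarrow> (\<forall>n. - real j - K * sqrt n \<le> lattice_walk e n)" for j
  proof -
    have "stays e (curve K j) n 0 0 \<longleftrightarrow> (\<forall>i\<in>{0..n}. - real j - K * sqrt i \<le> lattice_walk e i)" for n
      using stays_lattice_walk[of e "curve K j" n 0] by (simp add: curve_def ceiling_le_iff)
    then show ?thesis by (metis atLeastAtMost_iff le0 order_refl)
  qed
  have nat: "web_path e (real n) = lattice_walk e n" for n
    by (simp add: web_path_def frac_def Let_def)
  show ?thesis unfolding st
  proof
    assume "subdiffusive_plus K (web_path e)"
    then obtain j where j: "0 \<le> j" "\<And>t. 0 < t \<Longrightarrow> - j - K * sqrt t \<le> web_path e t"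
      by (auto simp: subdiffusive_plus_def)
    have "- real (nat \<lceil>j\<rceil>) - K * sqrt n \<le> lattice_walk e n" for n
    proof (cases "n = 0")
      case False
      have "j \<le> real (nat \<lceil>j\<rceil>)" by linarith
      then show ?thesis using j(2)[of "real n"] False unfolding nat by simp
    qed simp
    then show "\<exists>j. \<forall>n. - real j - K * sqrt n \<le> lattice_walk e n" by blast
  next
    assume "\<exists>j. \<forall>n. - real j - K * sqrt n \<le> lattice_walk e n"
    then obtain j where j: "\<And>n. - real j - K * sqrt n \<le> lattice_walk e n" by blast
    have "- (real j + 1) - K * sqrt t \<le> web_path e t" if t: "0 < t" for t
    proof -
      define n where "n = nat \<lfloor>t\<rfloor>"
      have n: "real n \<le> t" using t by (simp add: n_def)
      have step: "real_of_int (lattice_walk e n) - 1 \<le> lattice_walk e (Suc n)"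
        using sign_envD[OF e even_lattice_walk[OF e, of n]] by auto
      have f: "0 \<le> frac t" "frac t < 1" by (auto simp: frac_lt_1)
      have "real_of_int (lattice_walk e n) - 1 \<le> lattice_walk e n - frac t"
        using f by simp
      also have "\<dots> = (1 - frac t) * lattice_walk e n + frac t * (real_of_int (lattice_walk e n) - 1)"
        by (simp add: algebra_simps)
      also have "\<dots> \<le> (1 - frac t) * lattice_walk e n + frac t * lattice_walk e (Suc n)"
        by (intro add_left_mono mult_left_mono step f)
      also have "\<dots> = web_path e t" by (simp add: web_path_def n_def Let_def)
      finally have "real_of_int (lattice_walk e n) - 1 \<le> web_path e t" .
      moreover have "K * sqrt n \<le> K * sqrt t" using n K by (intro mult_left_mono) auto
      ultimately show ?thesis using j[of n] by linarith
    qed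
    then show "subdiffusive_plus K (web_path e)"
      unfolding subdiffusive_plus_def by (intro exI[of _ "real j + 1"]) auto
  qed
qed

text \<open>Paths up to a finite time depend on finitely many arrows, so they are eventually constant along a
  filter as soon as every single arrow is.\<close>

lemma eventually_stays_eq:
  assumes ev: "\<And>z. z \<in> even_lattice \<Longrightarrow> \<forall>\<^sub>F s in F. E s z = e z" and e: "sign_env e"
  shows "even (x + int t) \<Longrightarrow> \<forall>\<^sub>F s in F. stays (E s) c m t x = stays e c m t x"
proof (induction m arbitrary: t x)
  case (Suc m)
  have "\<forall>\<^sub>F s in F. E s (x, int t) = e (x, int t)"
    using Suc.prems by (intro ev) (auto simp: even_lattice_def)
  moreover have "\<forall>\<^sub>F s in F. stays (E s) c m (Suc t) (x + e (x, int t))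
      = stays e c m (Suc t) (x + e (x, int t))"
    using sign_envD[OF e Suc.prems] Suc.prems by (intro Suc.IH) auto
  ultimately show ?case by eventually_elim simp
qed simp

section \<open>The second moment method\<close>

lemma (in prob_space) second_moment:
  assumes I: "finite I" and A: "\<And>i. i \<in> I \<Longrightarrow> A i \<in> events"
  shows "(\<Sum>i\<in>I. prob (A i))\<^sup>2 \<le> prob (\<Union>i\<in>I. A i) * (\<Sum>i\<in>I. \<Sum>j\<in>I. prob (A i \<inter> A j))"
proof -
  define U where "U = (\<Union>i\<in>I. A i)"
  define S1 where "S1 = (\<Sum>i\<in>I. prob (A i))"
  define S2 where "S2 = (\<Sum>i\<in>I. \<Sum>j\<in>I. prob (A i \<inter> A j))"
  have U: "U \<in> events" using I A by (auto simp: U_def)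
  have q: "0 \<le> S2 - 2 * l * S1 + l\<^sup>2 * prob U" for l
  proof -
    define X where "X \<omega> = (\<Sum>i\<in>I. indicator (A i) \<omega> :: real)" for \<omega>
    have "(X \<omega> - l * indicator U \<omega>)\<^sup>2
        = (\<Sum>i\<in>I. \<Sum>j\<in>I. indicator (A i \<inter> A j) \<omega>) - 2 * l * (\<Sum>i\<in>I. indicator (A i) \<omega>)
            + l\<^sup>2 * indicator U \<omega>" for \<omega>
    proof (cases "\<omega> \<in> U")
      case True
      have "(X \<omega>)\<^sup>2 = (\<Sum>i\<in>I. \<Sum>j\<in>I. indicator (A i \<inter> A j) \<omega>)"
        by (simp add: X_def power2_eq_square sum_product indicator_inter_arith)
      then show ?thesis using True by (simp add: power2_diff X_def)
    next
      case False
      then have "\<omega> \<notin> A i" if "i \<in> I" for i using that by (auto simp: U_def)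
      then show ?thesis using False by (simp add: X_def)
    qed
    then have "0 \<le> (\<Sum>i\<in>I. \<Sum>j\<in>I. indicator (A i \<inter> A j) \<omega>) - 2 * l * (\<Sum>i\<in>I. indicator (A i) \<omega>)
        + l\<^sup>2 * indicator U \<omega>" for \<omega>
      by (metis zero_le_power2)
    then have "0 \<le> expectation (\<lambda>\<omega>. (\<Sum>i\<in>I. \<Sum>j\<in>I. indicator (A i \<inter> A j) \<omega>) - 2 * l
        * (\<Sum>i\<in>I. indicator (A i) \<omega>) + l\<^sup>2 * indicator U \<omega>)"
      by (intro Bochner_Integration.integral_nonneg) auto
    also have "\<dots> = S2 - 2 * l * S1 + l\<^sup>2 * prob U"
      using A U by (simp add: S1_def S2_def integrable_real_indicator emeasure_eq_measure sets.Int)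
    finally show ?thesis .
  qed
  have "S1\<^sup>2 \<le> prob U * S2"
  proof (cases "prob U = 0")
    case True
    have "prob (A i) \<le> prob U" if "i \<in> I" for i
      using that U by (intro finite_measure_mono) (auto simp: U_def)
    then have "prob (A i) = 0" if "i \<in> I" for i
      using that True by (metis measure_nonneg order_antisym)
    then have "S1 = 0" by (simp add: S1_def)
    then show ?thesis using True by simp
  next
    case False
    then have p: "0 < prob U" by (simp add: zero_less_measure_iff)
    \<comment> \<open>The minimiser of the quadratic in \<open>l\<close>.\<close>
    then show ?thesis using q[of "S1 / prob U"]
      by (simp add: power2_eq_square field_simps)
  qed
  then show ?thesis by (simp add: S1_def S2_def U_def)
qed

section \<open>Revealing two correlated environments\<close>

text \<open>A pair of environments of uniform arrows, independent over the sites, with correlation \<open>\<rho>\<close> at each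
  site. The event \<open>R\<close> is independent of both; it will be either the whole space or the event that a
  given clock rings.\<close>

locale correlated_environments = prob_space M for M :: "'a measure" +
  fixes X Y :: "int \<times> int \<Rightarrow> 'a \<Rightarrow> int" and \<rho> :: real and R :: "'a set"
  assumes R [measurable]: "R \<in> events"
    and meas: "z \<in> even_lattice \<Longrightarrow> random_variable (count_space UNIV) (X z)"
      "z \<in> even_lattice \<Longrightarrow> random_variable (count_space UNIV) (Y z)"
    and range: "z \<in> even_lattice \<Longrightarrow> \<omega> \<in> space M \<Longrightarrow> X z \<omega> \<in> {-1, 1}"
      "z \<in> even_lattice \<Longrightarrow> \<omega> \<in> space M \<Longrightarrow> Y z \<omega> \<in> {-1, 1}"
    and cylinder: "finite F \<Longrightarrow> F \<subseteq> even_lattice \<Longrightarrow> (\<And>z. a z \<in> {-1, 1}) \<Longrightarrow> (\<And>z. b z \<in> {-1, 1}) \<Longrightarrow>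
      prob {\<omega> \<in> R. \<forall>z\<in>F. X z \<omega> = a z \<and> Y z \<omega> = b z} =
      prob R * (\<Prod>z\<in>F. (1 + \<rho> * real_of_int (a z) * real_of_int (b z)) / 4)"
begin

text \<open>Conditionally on \<open>R\<close> and on any configuration of finitely many sites in \<open>S\<close>, the event \<open>Z\<close> has
  probability \<open>v\<close>. Events about the future of a path are built from such events backwards in time.\<close>

definition indep_past :: "(int \<times> int) set \<Rightarrow> real \<Rightarrow> 'a set \<Rightarrow> bool"
  where "indep_past S v Z \<longleftrightarrow> Z \<in> events \<and>
    (\<forall>F a b. finite F \<longrightarrow> F \<subseteq> S \<inter> even_lattice \<longrightarrow> (\<forall>z. a z \<in> {-1, 1}) \<longrightarrow> (\<forall>z. b z \<in> {-1, 1}) \<longrightarrow>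
      prob ({\<omega> \<in> R. \<forall>z\<in>F. X z \<omega> = a z \<and> Y z \<omega> = b z} \<inter> Z) =
      prob {\<omega> \<in> R. \<forall>z\<in>F. X z \<omega> = a z \<and> Y z \<omega> = b z} * v)"

lemma indep_past_antimono:
  assumes "indep_past S v Z" "T \<subseteq> S" shows "indep_past T v Z"
proof -
  have "F \<subseteq> S \<inter> even_lattice" if "F \<subseteq> T \<inter> even_lattice" for F
    using that assms(2) by blast
  then show ?thesis using assms(1) unfolding indep_past_def by simp
qed

lemma indep_past_space: "indep_past S 1 (space M)"
proof -
  have "{\<omega> \<in> R. P \<omega>} \<inter> space M = {\<omega> \<in> R. P \<omega>}" for P
    using sets.sets_into_space[OF R] by auto
  then show ?thesis unfolding indep_past_def by auto
qed

lemma indep_past_empty: "indep_past S 0 {}"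
  unfolding indep_past_def by auto

lemma indep_past_prob:
  assumes "indep_past S v Z" shows "prob (R \<inter> Z) = prob R * v"
  using assms[unfolded indep_past_def, THEN conjunct2, rule_format, of "{}" "\<lambda>_. 1" "\<lambda>_. 1"] by simp

lemma indep_past_reveal:
  assumes z: "z \<in> even_lattice" "z \<notin> S"
    and Z: "\<And>\<alpha> \<beta>. \<alpha> \<in> {-1, 1} \<Longrightarrow> \<beta> \<in> {-1, 1} \<Longrightarrow> indep_past (insert z S) (v \<alpha> \<beta>) (Z \<alpha> \<beta>)"
  shows "indep_past S (\<Sum>\<alpha>\<in>{-1, 1}. \<Sum>\<beta>\<in>{-1, 1}. (1 + \<rho> * real_of_int \<alpha> * real_of_int \<beta>) / 4 * v \<alpha> \<beta>)
    {\<omega> \<in> space M. \<omega> \<in> Z (X z \<omega>) (Y z \<omega>)}"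
  unfolding indep_past_def
proof (intro conjI allI impI)
  note [measurable] = meas[OF z(1)]
  have Zev: "Z \<alpha> \<beta> \<in> events" if "\<alpha> \<in> {-1, 1}" "\<beta> \<in> {-1, 1}" for \<alpha> \<beta>
    using Z[OF that] by (simp add: indep_past_def)
  have "{\<omega> \<in> space M. \<omega> \<in> Z (X z \<omega>) (Y z \<omega>)} =
      (\<Union>\<alpha>\<in>{-1, 1}. \<Union>\<beta>\<in>{-1, 1}. {\<omega> \<in> space M. X z \<omega> = \<alpha> \<and> Y z \<omega> = \<beta>} \<inter> Z \<alpha> \<beta>)"
    using range[OF z(1)] by fastforce
  also have "\<dots> \<in> events"
    using Zev by (intro sets.finite_UN sets.Int) (auto, measurable)
  finally show "{\<omega> \<in> space M. \<omega> \<in> Z (X z \<omega>) (Y z \<omega>)} \<in> events" .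
  fix F and a b :: "int \<times> int \<Rightarrow> int"
  assume F: "finite F" "F \<subseteq> S \<inter> even_lattice"
    and a: "\<forall>z. a z \<in> {-1, 1::int}" and b: "\<forall>z. b z \<in> {-1, 1::int}"
  define C where "C = {\<omega> \<in> R. \<forall>z\<in>F. X z \<omega> = a z \<and> Y z \<omega> = b z}"
  define C' where "C' p = {\<omega> \<in> R. \<forall>y\<in>insert z F. X y \<omega> = (a(z := fst p)) y \<and> Y y \<omega> = (b(z := snd p)) y}" for p
  define I where "I = {-1, 1::int} \<times> {-1, 1::int}"
  have zF: "z \<notin> F" using z F by auto
  have C'_eq: "C' p = C \<inter> {\<omega>. X z \<omega> = fst p \<and> Y z \<omega> = snd p}" for p
    using zF unfolding C_def C'_def by auto
  have C_eq: "prob C = prob R * (\<Prod>z\<in>F. (1 + \<rho> * real_of_int (a z) * real_of_int (b z)) / 4)"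
    unfolding C_def using F a b by (intro cylinder) auto
  have step: "prob (C' p \<inter> Z (fst p) (snd p)) = prob C * ((1
      + \<rho> * real_of_int (fst p) * real_of_int (snd p)) / 4 * v (fst p) (snd p))"
    if p: "p \<in> I" for p
  proof -
    have p': "fst p \<in> {-1, 1}" "snd p \<in> {-1, 1}" using p by (auto simp: I_def)
    have "prob (C' p \<inter> Z (fst p) (snd p)) = prob (C' p) * v (fst p) (snd p)"
    proof -
      have "finite (insert z F)" "insert z F \<subseteq> insert z S \<inter> even_lattice"
        "\<forall>y. (a(z := fst p)) y \<in> {-1, 1}" "\<forall>y. (b(z := snd p)) y \<in> {-1, 1}"
        using F z(1) a b p' by auto
      with Z[OF p'] show ?thesis
        unfolding indep_past_def C'_def by blast
    qed
    also have "prob (C' p) = prob R * (\<Prod>y\<in>insert z F. (1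
        + \<rho> * real_of_int ((a(z := fst p)) y) * real_of_int ((b(z := snd p)) y)) / 4)"
      unfolding C'_def using F a b p' z by (intro cylinder) auto
    also have "\<dots> = prob R * ((1 + \<rho> * real_of_int (fst p) * real_of_int (snd p)) / 4 * (\<Prod>z\<in>F. (1
        + \<rho> * real_of_int (a z) * real_of_int (b z)) / 4))"
      using F(1) zF by (subst prod.insert) (auto intro!: prod.cong)
    finally show ?thesis by (simp add: C_eq)
  qed
  have C'ev: "C' p \<in> events" for p
  proof -
    have "C' p = R \<inter> (\<Inter>y\<in>insert z F. {\<omega> \<in> space M. X y \<omega> = (a(z := fst p)) y} \<inter> {\<omega> \<in> space M. Y y \<omega>
        = (b(z := snd p)) y})"
      using sets.sets_into_space[OF R] unfolding C'_def by auto
    also have "\<dots> \<in> events"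
    proof (intro sets.Int R sets.finite_INT)
      fix y assume "y \<in> insert z F"
      then have y: "y \<in> even_lattice" using z F by auto
      note [measurable] = meas[OF y]
      show "{\<omega> \<in> space M. X y \<omega> = (a(z := fst p)) y} \<in> events" by measurable
      show "{\<omega> \<in> space M. Y y \<omega> = (b(z := snd p)) y} \<in> events" by measurable
    qed (use F in auto)
    finally show ?thesis .
  qed
  have "C \<inter> {\<omega> \<in> space M. \<omega> \<in> Z (X z \<omega>) (Y z \<omega>)} = (\<Union>p\<in>I. C' p \<inter> Z (fst p) (snd p))"
  proof -
    have "\<omega> \<in> space M \<and> X z \<omega> \<in> {-1, 1} \<and> Y z \<omega> \<in> {-1, 1}" if "\<omega> \<in> C" for \<omega>
      using that sets.sets_into_space[OF R] range[OF z(1)] by (auto simp: C_def)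
    then show ?thesis unfolding C'_eq I_def by fastforce
  qed
  also have "prob \<dots> = (\<Sum>p\<in>I. prob (C' p \<inter> Z (fst p) (snd p)))"
  proof (rule finite_measure_finite_Union)
    show "disjoint_family_on (\<lambda>p. C' p \<inter> Z (fst p) (snd p)) I"
      unfolding C'_eq disjoint_family_on_def by (auto simp: prod_eq_iff)
    show "(\<lambda>p. C' p \<inter> Z (fst p) (snd p)) ` I \<subseteq> events"
      using C'ev Zev by (auto simp: I_def)
  qed (simp add: I_def)
  also have "\<dots> = (\<Sum>p\<in>I. prob C * ((1 + \<rho> * real_of_int (fst p) * real_of_int (snd p)) / 4
      * v (fst p) (snd p)))"
    by (intro sum.cong step) auto
  also have "\<dots> = prob C * (\<Sum>\<alpha>\<in>{-1, 1}. \<Sum>\<beta>\<in>{-1, 1}. (1 + \<rho> * real_of_int \<alpha> * real_of_int \<beta>) / 4 * v \<alpha> \<beta>)"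
    unfolding I_def sum_distrib_left [symmetric]
    by (simp only: sum.cartesian_product case_prod_unfold)
  finally show "prob ({\<omega> \<in> R. \<forall>z\<in>F. X z \<omega> = a z \<and> Y z \<omega> = b z} \<inter> {\<omega> \<in> space M. \<omega> \<in> Z (X z \<omega>) (Y z \<omega>)})
    = prob {\<omega> \<in> R. \<forall>z\<in>F. X z \<omega> = a z \<and> Y z \<omega> = b z} * (\<Sum>\<alpha>\<in>{-1, 1}. \<Sum>\<beta>\<in>{-1, 1}. (1
        + \<rho> * real_of_int \<alpha> * real_of_int \<beta>) / 4 * v \<alpha> \<beta>)"
    unfolding C_def .
qed

abbreviation before :: "nat \<Rightarrow> (int \<times> int) set"
  where "before t \<equiv> {(x, s). s < int t}"

text \<open>One level of the environment is revealed per step: one site if the two paths have met, and two sites,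
  hence independent arrows, otherwise. The event \<open>Z\<close>, which concerns later levels, makes it possible
  to treat the strips one after another.\<close>

lemma indep_past_stays:
  "indep_past (before (t + m)) v Z \<Longrightarrow> even (x + int t) \<Longrightarrow> even (y + int t) \<Longrightarrow>
    indep_past (before t) (pair_surv \<rho> c m t x y * v)
      {\<omega> \<in> Z. stays (\<lambda>z. X z \<omega>) c m t x \<and> stays (\<lambda>z. Y z \<omega>) c m t y}"
proof (induction m arbitrary: t x y)
  case 0
  then show ?case by (auto simp: indep_past_empty)
next
  case (Suc m)
  define E where "E u w = {\<omega> \<in> Z. stays (\<lambda>z. X z \<omega>) c m (Suc t) u \<and> stays (\<lambda>z. Y z \<omega>) c m (Suc t) w}" for u w
  define P where "P u w = pair_surv \<rho> c m (Suc t) u w" for u w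
  have IH: "indep_past (before (Suc t)) (P u w * v) (E u w)"
    if "even (u + int (Suc t))" "even (w + int (Suc t))" for u w
    unfolding P_def E_def using Suc.prems(1) that by (intro Suc.IH) auto
  have L: "(x, int t) \<in> even_lattice" "(y, int t) \<in> even_lattice"
    using Suc.prems by (auto simp: even_lattice_def)
  have Zs: "Z \<subseteq> space M"
    using Suc.prems(1) sets.sets_into_space by (auto simp: indep_past_def)
  show ?case
  proof (cases "c t \<le> x \<and> c t \<le> y")
    case False
    then show ?thesis by (auto simp: indep_past_empty)
  next
    case c: True
    show ?thesis
    proof (cases "x = y")
      case True
      have "indep_past (before t)
         (\<Sum>\<alpha>\<in>{-1, 1}. \<Sum>\<beta>\<in>{-1, 1}. (1 + \<rho> * real_of_int \<alpha> * real_of_int \<beta>) / 4 * (P (x + \<alpha>) (x + \<beta>) * v))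
         {\<omega> \<in> space M. \<omega> \<in> E (x + X (x, int t) \<omega>) (x + Y (x, int t) \<omega>)}"
        using Suc.prems
        by (intro indep_past_reveal L(1) indep_past_antimono[OF IH]) auto
      moreover have "{\<omega> \<in> space M. \<omega> \<in> E (x + X (x, int t) \<omega>) (x + Y (x, int t) \<omega>)} =
          {\<omega> \<in> Z. stays (\<lambda>z. X z \<omega>) c (Suc m) t x \<and> stays (\<lambda>z. Y z \<omega>) c (Suc m) t y}"
        using c Zs True by (auto simp: E_def)
      moreover have "(\<Sum>\<alpha>\<in>{-1, 1}. \<Sum>\<beta>\<in>{-1, 1}. (1 + \<rho> * real_of_int \<alpha> * real_of_int \<beta>) / 4 * (P (x
          + \<alpha>) (x + \<beta>) * v))
          = pair_surv \<rho> c (Suc m) t x y * v"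
        using c True by (simp add: P_def algebra_simps)
      ultimately show ?thesis by simp
    next
      case False
      define S where "S \<alpha> = (\<Sum>\<gamma>\<in>{-1, 1}. \<Sum>\<delta>\<in>{-1, 1}.
          (1 + \<rho> * real_of_int \<gamma> * real_of_int \<delta>) / 4 * (P (x + \<alpha>) (y + \<delta>) * v))" for \<alpha>
      have inner: "indep_past (insert (x, int t) (before t)) (S \<alpha>)
          {\<omega> \<in> space M. \<omega> \<in> E (x + \<alpha>) (y + Y (y, int t) \<omega>)}" if "\<alpha> \<in> {-1, 1}" for \<alpha>
        unfolding S_def using Suc.prems False that
        by (intro indep_past_reveal[where Z = "\<lambda>\<gamma> \<delta>. E (x + \<alpha>) (y + \<delta>)"] L(2) indep_past_antimono[OF IH]) auto
      have "indep_past (before t)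
         (\<Sum>\<alpha>\<in>{-1, 1}. \<Sum>\<beta>\<in>{-1, 1}. (1 + \<rho> * real_of_int \<alpha> * real_of_int \<beta>) / 4 * S \<alpha>)
         {\<omega> \<in> space M. \<omega> \<in> {\<omega>' \<in> space M. \<omega>' \<in> E (x + X (x, int t) \<omega>) (y + Y (y, int t) \<omega>')}}"
        by (intro indep_past_reveal[where v = "\<lambda>\<alpha> \<beta>. S \<alpha>"
              and Z = "\<lambda>\<alpha> \<beta>. {\<omega> \<in> space M. \<omega> \<in> E (x + \<alpha>) (y + Y (y, int t) \<omega>)}"] L(1) inner) auto
      moreover have "{\<omega> \<in> space M. \<omega> \<in> {\<omega>' \<in> space M. \<omega>' \<in> E (x + X (x, int t) \<omega>) (y + Y (y, int t) \<omega>')}} =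
          {\<omega> \<in> Z. stays (\<lambda>z. X z \<omega>) c (Suc m) t x \<and> stays (\<lambda>z. Y z \<omega>) c (Suc m) t y}"
        using c Zs by (auto simp: E_def)
      moreover have "(\<Sum>\<alpha>\<in>{-1, 1}. \<Sum>\<beta>\<in>{-1, 1}. (1 + \<rho> * real_of_int \<alpha> * real_of_int \<beta>) / 4 * S \<alpha>)
          = pair_surv \<rho> c (Suc m) t x y * v"
        using c False by (simp add: P_def S_def field_simps)
      ultimately show ?thesis by simp
    qed
  qed
qed

lemma indep_past_strips:
  assumes "k \<le> N"
  shows "indep_past (before (strip_time k)) (\<Prod>i\<in>{k..<N}. strip_pair_prob \<rho> i)
    {\<omega> \<in> space M. \<forall>i\<in>{k..<N}. stays_in_strip (\<lambda>z. X z \<omega>) i \<and> stays_in_strip (\<lambda>z. Y z \<omega>) i}"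
  using assms
proof (induction k rule: inc_induct)
  case base
  show ?case using indep_past_space by simp
next
  case (step k)
  have k: "{k..<N} = insert k {Suc k..<N}" using step by auto
  have "indep_past (before (strip_time k)) (strip_pair_prob \<rho> k * (\<Prod>i\<in>{Suc k..<N}. strip_pair_prob \<rho> i))
     {\<omega> \<in> {\<omega> \<in> space M. \<forall>i\<in>{Suc k..<N}. stays_in_strip (\<lambda>z. X z \<omega>) i \<and> stays_in_strip (\<lambda>z. Y z \<omega>) i}.
        stays_in_strip (\<lambda>z. X z \<omega>) k \<and> stays_in_strip (\<lambda>z. Y z \<omega>) k}"
    unfolding strip_pair_prob_def[of \<rho> k] stays_in_strip_def[of _ k]
    by (rule indep_past_stays) (use step.IH even_strip in \<open>auto simp: strip_time_Suc\<close>)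
  moreover have "{\<omega> \<in> {\<omega> \<in> space M. \<forall>i\<in>{Suc k..<N}. stays_in_strip (\<lambda>z. X z \<omega>) i \<and> stays_in_strip (\<lambda>z. Y
      z \<omega>) i}.
        stays_in_strip (\<lambda>z. X z \<omega>) k \<and> stays_in_strip (\<lambda>z. Y z \<omega>) k} =
    {\<omega> \<in> space M. \<forall>i\<in>{k..<N}. stays_in_strip (\<lambda>z. X z \<omega>) i \<and> stays_in_strip (\<lambda>z. Y z \<omega>) i}"
    unfolding k by auto
  ultimately show ?case unfolding k by simp
qed

end

section \<open>The environments of the dynamical discrete web\<close>

lemma (in prob_space) prob_eq_cmult_of_slices:
  fixes D :: "'a \<Rightarrow> nat"
  assumes [measurable]: "random_variable (count_space UNIV) D" "P \<in> events" "Q \<in> events"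
    and eq: "\<And>d. prob {\<omega> \<in> P. D \<omega> = d} = c * prob {\<omega> \<in> Q. D \<omega> = d}"
  shows "prob P = c * prob Q"
proof -
  have s: "(\<lambda>d. prob {\<omega> \<in> A. D \<omega> = d}) sums prob A" if [measurable]: "A \<in> events" for A
  proof -
    have A: "A \<subseteq> space M" using that by (rule sets.sets_into_space)
    have ev: "{\<omega> \<in> A. D \<omega> = d} \<in> events" for d
    proof -
      have "A \<inter> {\<omega> \<in> space M. D \<omega> = d} \<in> events" by measurable
      also have "A \<inter> {\<omega> \<in> space M. D \<omega> = d} = {\<omega> \<in> A. D \<omega> = d}" using A by auto
      finally show ?thesis .
    qed
    have "(\<lambda>d. prob {\<omega> \<in> A. D \<omega> = d}) sums prob (\<Union>d. {\<omega> \<in> A. D \<omega> = d})"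
      by (intro finite_measure_UNION) (use ev in \<open>auto simp: disjoint_family_on_def\<close>)
    also have "(\<Union>d. {\<omega> \<in> A. D \<omega> = d}) = A" by auto
    finally show ?thesis .
  qed
  have "(\<lambda>d. c * prob {\<omega> \<in> Q. D \<omega> = d}) sums (c * prob Q)"
    by (intro sums_mult s) fact
  moreover have "(\<lambda>d. c * prob {\<omega> \<in> Q. D \<omega> = d}) sums prob P"
    using s[OF assms(2)] unfolding eq .
  ultimately show ?thesis by (rule sums_unique2 [symmetric])
qed

context dynamical_discrete_web
begin

definition clock_algebra :: "int \<times> int \<Rightarrow> 'a measure"
  where "clock_algebra z = vimage_algebra (space M) (\<lambda>\<omega>. \<lambda>\<tau>\<in>{0..}. clock z \<tau> \<omega>)
    (\<Pi>\<^sub>M \<tau>\<in>{0..}. count_space UNIV)"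

definition val_algebra :: "int \<times> int \<Rightarrow> nat \<Rightarrow> 'a measure"
  where "val_algebra z k = vimage_algebra (space M) (val z k) (count_space UNIV)"

lemma space_clock_algebra [simp]: "space (clock_algebra z) = space M"
  by (simp add: clock_algebra_def)

lemma space_val_algebra [simp]: "space (val_algebra z k) = space M"
  by (simp add: val_algebra_def)

lemma clock_measurable [measurable]:
  "0 \<le> s \<Longrightarrow> clock z s \<in> measurable (clock_algebra z) (count_space UNIV)"
proof -
  assume s: "0 \<le> s"
  have "(\<lambda>\<omega>. \<lambda>\<tau>\<in>{0..}. clock z \<tau> \<omega>) \<in> measurable (clock_algebra z) (\<Pi>\<^sub>M \<tau>\<in>{0..}. count_space UNIV)"
    unfolding clock_algebra_def by (rule measurable_vimage_algebra1) (auto simp: space_PiM)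
  from measurable_compose[OF this measurable_component_singleton[of s]]
  show ?thesis using s by simp
qed

lemma clock_in_clock_algebra:
  assumes "0 \<le> s" shows "{\<omega> \<in> space M. clock z s \<omega> = k} \<in> sets (clock_algebra z)"
proof -
  have "clock z s -` {k} \<inter> space (clock_algebra z) \<in> sets (clock_algebra z)"
    by (rule measurable_sets[OF clock_measurable[OF assms]]) simp
  also have "clock z s -` {k} \<inter> space (clock_algebra z) = {\<omega> \<in> space M. clock z s \<omega> = k}" by auto
  finally show ?thesis .
qed

lemma val_in_val_algebra: "{\<omega> \<in> space M. val z k \<omega> \<in> A} \<in> sets (val_algebra z k)"
proof -
  have "val z k -` A \<inter> space M \<in> sets (val_algebra z k)"
    unfolding val_algebra_def by (rule in_vimage_algebra) simp
  also have "val z k -` A \<inter> space M = {\<omega> \<in> space M. val z k \<omega> \<in> A}" by auto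
  finally show ?thesis .
qed

definition web_algebra :: "(int \<times> int) + (int \<times> int) \<times> nat \<Rightarrow> 'a set set"
  where "web_algebra i = (case i of Inl z \<Rightarrow> sets (clock_algebra z) | Inr (z, k) \<Rightarrow> sets (val_algebra z k))"

lemma indep_web_algebra: "indep_sets web_algebra (even_lattice <+> even_lattice \<times> UNIV)"
proof -
  have "web_algebra = (\<lambda>i. case i of
         Inl z \<Rightarrow> sets (vimage_algebra (space M) (\<lambda>\<omega>. \<lambda>\<tau>\<in>{0..}. clock z \<tau> \<omega>)
                         (\<Pi>\<^sub>M \<tau>\<in>{0..}. count_space UNIV))
       | Inr (z, k) \<Rightarrow> sets (vimage_algebra (space M) (val z k) (count_space UNIV)))"
    by (rule ext) (simp only: web_algebra_def clock_algebra_def val_algebra_def)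
  then show ?thesis using indep by (simp only:)
qed

lemma web_algebra_events: "i \<in> even_lattice <+> even_lattice \<times> UNIV \<Longrightarrow> web_algebra i \<subseteq> events"
  using indep_web_algebra[unfolded indep_sets_def, THEN conjunct1] by (rule bspec)

lemma clock_algebra_events: "z \<in> even_lattice \<Longrightarrow> A \<in> sets (clock_algebra z) \<Longrightarrow> A \<in> events"
  using subsetD[OF web_algebra_events[OF InlI]] by (simp add: web_algebra_def)

lemma prob_val: "z \<in> even_lattice \<Longrightarrow> a \<in> {-1, 1} \<Longrightarrow> prob {\<omega> \<in> space M. val z k \<omega> = a} = 1 / 2"
proof -
  assume z: "z \<in> even_lattice" and a: "a \<in> {-1, 1}"
  have "prob {\<omega> \<in> space M. val z k \<omega> = a} = prob (val z k -` {a} \<inter> space M)"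
    by (intro arg_cong[where f = prob]) auto
  also have "\<dots> = measure (distr M (count_space UNIV) (val z k)) {a}"
    using val_measurable[OF z] by (simp add: measure_distr)
  also have "\<dots> = 1 / 2"
    using a unfolding val_uniform[OF z] by (auto simp: measure_pmf_single)
  finally show ?thesis .
qed

lemma prob_clock_val_val:
  assumes z: "z \<in> even_lattice" and A: "A \<in> sets (clock_algebra z)" and a: "a \<in> {-1, 1}" "b \<in> {-1, 1}"
  shows "prob {\<omega> \<in> A. val z k \<omega> = a \<and> val z l \<omega> = b} =
    (if k = l then of_bool (a = b) / 2 else 1 / 4) * prob A"
proof -
  have As: "A \<subseteq> space M" using sets.sets_into_space[OF A] by simp
  define V where "V k a = {\<omega> \<in> space M. val z k \<omega> = a}" for k a
  have V: "V k a \<in> sets (val_algebra z k)" for k a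
    using val_in_val_algebra[of z k "{a}"] by (simp add: V_def)
  define B where "B i = (case i of Inl _ \<Rightarrow> A | Inr (_, m) \<Rightarrow> V m (if m = k then a else b))"
    for i :: "(int \<times> int) + (int \<times> int) \<times> nat"
  have B: "B i \<in> web_algebra i" if "i \<in> {Inl z, Inr (z, k), Inr (z, l)}" for i
    using that A V by (auto simp: B_def web_algebra_def)
  show ?thesis
  proof (cases "k = l")
    case True
    show ?thesis
    proof (cases "a = b")
      case True
      have "prob (\<Inter>i\<in>{Inl z, Inr (z, k)}. B i) = (\<Prod>i\<in>{Inl z, Inr (z, k)}. prob (B i))"
        using z B by (intro indep_setsD[OF indep_web_algebra]) auto
      also have "(\<Inter>i\<in>{Inl z, Inr (z, k)}. B i) = {\<omega> \<in> A. val z k \<omega> = a}"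
        using As by (auto simp: B_def V_def)
      finally show ?thesis using True \<open>k = l\<close> prob_val[OF z a(1)] by (simp add: B_def V_def)
    next
      case False
      then have e: "{\<omega> \<in> A. val z k \<omega> = a \<and> val z l \<omega> = b} = {}" using \<open>k = l\<close> by auto
      show ?thesis unfolding e using False \<open>k = l\<close> by simp
    qed
  next
    case False
    have "prob (\<Inter>i\<in>{Inl z, Inr (z, k), Inr (z, l)}. B i) = (\<Prod>i\<in>{Inl z, Inr (z, k), Inr (z, l)}. prob (B i))"
      using z B by (intro indep_setsD[OF indep_web_algebra]) auto
    also have "(\<Inter>i\<in>{Inl z, Inr (z, k), Inr (z, l)}. B i) = {\<omega> \<in> A. val z k \<omega> = a \<and> val z l \<omega> = b}"
      using As False by (auto simp: B_def V_def)
    finally show ?thesis using False prob_val[OF z a(1)] prob_val[OF z a(2)] by (simp add: B_def V_def)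
  qed
qed

lemma xi_measurable:
  assumes z: "z \<in> even_lattice" and s: "0 \<le> s"
    and N: "space N = space M" "sets (clock_algebra z) \<subseteq> sets N" "\<And>k. sets (val_algebra z k) \<subseteq> sets N"
  shows "\<xi> z s \<in> measurable N (count_space UNIV)"
proof -
  have c: "clock z s \<in> measurable N (count_space UNIV)"
    using clock_measurable[OF s, of z] N(1,2) by (auto simp: measurable_def)
  have v: "val z k \<in> measurable N (count_space UNIV)" for k
  proof (rule measurableI)
    fix A :: "int set"
    have "val z k -` A \<inter> space N = {\<omega> \<in> space M. val z k \<omega> \<in> A}" using N(1) by auto
    then show "val z k -` A \<inter> space N \<in> sets N"
      using subsetD[OF N(3) val_in_val_algebra[of z k A]] by simp
  qed auto
  have "(\<lambda>\<omega>. val z (clock z s \<omega>) \<omega>) \<in> measurable N (count_space UNIV)"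
    by (rule measurable_compose_countable[OF v c])
  then show ?thesis
    by (rule measurable_cong[THEN iffD1, rotated]) (use N z s \<xi>_eq in auto)
qed

lemma val_algebra_events: "z \<in> even_lattice \<Longrightarrow> sets (val_algebra z k) \<subseteq> events"
  using web_algebra_events[of "Inr (z, k)"] by (simp add: web_algebra_def InrI)

lemma xi_random_variable:
  assumes z: "z \<in> even_lattice" and s: "0 \<le> s" shows "random_variable (count_space UNIV) (\<xi> z s)"
  by (rule xi_measurable[OF z s refl subsetI[OF clock_algebra_events[OF z]] val_algebra_events[OF z]])

lemma clock_random_variable:
  assumes z: "z \<in> even_lattice" and s: "0 \<le> s" shows "random_variable (count_space UNIV) (clock z s)"
  by (rule measurable_mono[THEN subsetD, OF _ _ _ _ clock_measurable[OF s, of z]])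
    (simp_all add: subsetI[OF clock_algebra_events[OF z]])

lemma xi_range:
  assumes "z \<in> even_lattice" "0 \<le> s" "\<omega> \<in> space M" shows "\<xi> z s \<omega> \<in> {-1, 1}"
  unfolding \<xi>_eq[OF assms] by (rule val_range[OF assms(1,3)])

text \<open>The random indices of the two draws are countably many, and for fixed indices the values are
  independent of the clock.\<close>

lemma prob_xi_xi_conditional:
  assumes z: "z \<in> even_lattice" and s: "0 \<le> s" "0 \<le> s'" and a: "a \<in> {-1, 1}" "b \<in> {-1, 1}"
    and A: "A \<in> sets (clock_algebra z)"
    and c: "(\<forall>\<omega>\<in>A. clock z s \<omega> = clock z s' \<omega>) \<and> c = of_bool (a = b) / 2 \<or>
      (\<forall>\<omega>\<in>A. clock z s \<omega> \<noteq> clock z s' \<omega>) \<and> c = 1 / 4"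
  shows "prob {\<omega> \<in> A. \<xi> z s \<omega> = a \<and> \<xi> z s' \<omega> = b} = c * prob A"
proof (rule prob_eq_cmult_of_slices[where D = "\<lambda>\<omega>. prod_encode (clock z s \<omega>, clock z s' \<omega>)"])
  note [measurable] = clock_random_variable[OF z s(1)] clock_random_variable[OF z s(2)]
    xi_random_variable[OF z s(1)] xi_random_variable[OF z s(2)]
  show "random_variable (count_space UNIV) (\<lambda>\<omega>. prod_encode (clock z s \<omega>, clock z s' \<omega>))"
    by measurable
  show Aev: "A \<in> events" by (rule clock_algebra_events[OF z A])
  have As: "A \<subseteq> space M" using sets.sets_into_space[OF A] by simp
  have "{\<omega> \<in> A. \<xi> z s \<omega> = a \<and> \<xi> z s' \<omega> = b} = A \<inter> {\<omega> \<in> space M. \<xi> z s \<omega> = a \<and> \<xi> z s' \<omega> = b}"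
    using As by auto
  also have "\<dots> \<in> events" using Aev by measurable
  finally show "{\<omega> \<in> A. \<xi> z s \<omega> = a \<and> \<xi> z s' \<omega> = b} \<in> events" .
  fix d
  obtain k l where d: "d = prod_encode (k, l)" by (metis surj_pair prod_decode_inverse)
  define B where "B = {\<omega> \<in> A. clock z s \<omega> = k \<and> clock z s' \<omega> = l}"
  have "B = A \<inter> ({\<omega> \<in> space M. clock z s \<omega> = k} \<inter> {\<omega> \<in> space M. clock z s' \<omega> = l})"
    using As by (auto simp: B_def)
  also have "\<dots> \<in> sets (clock_algebra z)"
    by (intro sets.Int A clock_in_clock_algebra s)
  finally have B: "B \<in> sets (clock_algebra z)" .
  have "{\<omega> \<in> {\<omega> \<in> A. \<xi> z s \<omega> = a \<and> \<xi> z s' \<omega> = b}. prod_encode (clock z s \<omega>, clock z s' \<omega>) = d}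
      = {\<omega> \<in> B. val z k \<omega> = a \<and> val z l \<omega> = b}"
    using As \<xi>_eq[OF z s(1)] \<xi>_eq[OF z s(2)] by (auto simp: B_def d)
  then have "prob {\<omega> \<in> {\<omega> \<in> A. \<xi> z s \<omega> = a \<and> \<xi> z s' \<omega> = b}. prod_encode (clock z s \<omega>, clock z s' \<omega>) = d}
      = (if k = l then of_bool (a = b) / 2 else 1 / 4) * prob B"
    using prob_clock_val_val[OF z B a] by simp
  also have "\<dots> = c * prob B"
  proof (cases "B = {}")
    case False
    then show ?thesis using c by (auto simp: B_def)
  qed simp
  also have "B = {\<omega> \<in> A. prod_encode (clock z s \<omega>, clock z s' \<omega>) = d}"
    by (auto simp: B_def d)
  finally show "prob {\<omega> \<in> {\<omega> \<in> A. \<xi> z s \<omega> = a \<and> \<xi> z s' \<omega> = b}. prod_encode (clock z s \<omega>, clock z s' \<omega>) = d}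
      = c * prob {\<omega> \<in> A. prod_encode (clock z s \<omega>, clock z s' \<omega>) = d}" .
qed

definition rings :: "int \<times> int \<Rightarrow> real \<Rightarrow> real \<Rightarrow> 'a set"
  where "rings z s s' = {\<omega> \<in> space M. clock z s \<omega> \<noteq> clock z s' \<omega>}"

lemma rings_in_clock_algebra: "0 \<le> s \<Longrightarrow> 0 \<le> s' \<Longrightarrow> rings z s s' \<in> sets (clock_algebra z)"
proof -
  assume s: "0 \<le> s" "0 \<le> s'"
  have "rings z s s' = (\<Union>k. {\<omega> \<in> space M. clock z s \<omega> = k} - {\<omega> \<in> space M. clock z s' \<omega> = k})"
    by (auto simp: rings_def)
  also have "\<dots> \<in> sets (clock_algebra z)"
    using sets.Diff[OF clock_in_clock_algebra[OF s(1), where z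
        = z] clock_in_clock_algebra[OF s(2), where z = z]]
    by (intro sets.countable_UN') auto
  finally show ?thesis .
qed

lemma clock_mono:
  assumes "z \<in> even_lattice" "\<omega> \<in> space M" "0 \<le> s" "s \<le> s'"
  shows "clock z s \<omega> \<le> clock z s' \<omega>"
  using clock[OF assms(1)] assms unfolding poisson_process_def by (auto dest!: bspec elim!: mono_onD)

lemma prob_rings:
  assumes z: "z \<in> even_lattice" and s: "0 \<le> s" "s \<le> s'"
  shows "prob (rings z s s') = 1 - exp (- (s' - s))"
proof (cases "s = s'")
  case True
  then show ?thesis by (simp add: rings_def)
next
  case False
  then have lt: "s < s'" using s by simp
  note [measurable] = clock_random_variable[OF z s(1)] clock_random_variable[OF z order.trans[OF s]]
  have D: "distr M (count_space UNIV) (\<lambda>\<omega>. clock z s' \<omega> - clock z s \<omega>)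
      = measure_pmf (poisson_pmf (1 * (s' - s)))"
    using clock[OF z] s(1) lt unfolding poisson_process_def by blast
  have "space M - rings z s s' = (\<lambda>\<omega>. clock z s' \<omega> - clock z s \<omega>) -` {0} \<inter> space M"
    using clock_mono[OF z _ s] by (auto simp: le_antisym rings_def)
  then have "prob (space M - rings z s s')
      = measure (distr M (count_space UNIV) (\<lambda>\<omega>. clock z s' \<omega> - clock z s \<omega>)) {0}"
    by (simp add: measure_distr)
  also have "\<dots> = exp (- (s' - s))"
    unfolding D using lt by (simp add: measure_pmf_single)
  finally have "prob (space M - rings z s s') = exp (- (s' - s))" .
  then show ?thesis
    using prob_compl[OF clock_algebra_events[OF z rings_in_clock_algebra[OF s(1) order.trans[OF s]]]]
    by simp
qed

text \<open>The arrows at the two times are the same draw if the clock has not rung in between, which has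
  probability \<open>exp (- (s' - s))\<close>, and otherwise two independent draws.\<close>

lemma prob_xi_pair:
  assumes z: "z \<in> even_lattice" and s: "0 \<le> s" "s \<le> s'" and a: "a \<in> {-1, 1}" "b \<in> {-1, 1}"
  shows "prob {\<omega> \<in> space M. \<xi> z s \<omega> = a \<and> \<xi> z s' \<omega> = b}
      = (1 + exp (- (s' - s)) * real_of_int a * real_of_int b) / 4"
proof -
  have s': "0 \<le> s'" using s by simp
  note [measurable] = xi_random_variable[OF z s(1)] xi_random_variable[OF z s']
  let ?R = "rings z s s'" and ?P = "\<lambda>\<omega>. \<xi> z s \<omega> = a \<and> \<xi> z s' \<omega> = b"
  have R: "?R \<in> sets (clock_algebra z)" using rings_in_clock_algebra[OF s(1) s'] .
  then have R': "space M - ?R \<in> sets (clock_algebra z)" using sets.compl_sets[OF R] by simp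
  note Rev = clock_algebra_events[OF z R] clock_algebra_events[OF z R']
  have c: "prob (space M - ?R) = exp (- (s' - s))"
    using prob_compl[OF Rev(1)] prob_rings[OF z s] by simp
  have p1: "prob {\<omega> \<in> ?R. ?P \<omega>} = 1 / 4 * prob ?R"
    by (rule prob_xi_xi_conditional[OF z s(1) s' a R]) (auto simp: rings_def)
  have p2: "prob {\<omega> \<in> space M - ?R. ?P \<omega>} = of_bool (a = b) / 2 * prob (space M - ?R)"
    by (rule prob_xi_xi_conditional[OF z s(1) s' a R']) (auto simp: rings_def)
  have "prob {\<omega> \<in> space M. ?P \<omega>} = prob {\<omega> \<in> ?R. ?P \<omega>} + prob {\<omega> \<in> space M - ?R. ?P \<omega>}"
  proof -
    have P: "{\<omega> \<in> space M. ?P \<omega>} \<in> events" by measurable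
    have "{\<omega> \<in> ?R. ?P \<omega>} = ?R \<inter> {\<omega> \<in> space M. ?P \<omega>}" "{\<omega> \<in> space M - ?R. ?P \<omega>}
        = (space M - ?R) \<inter> {\<omega> \<in> space M. ?P \<omega>}"
      by (auto simp: rings_def)
    then have "{\<omega> \<in> ?R. ?P \<omega>} \<in> events" "{\<omega> \<in> space M - ?R. ?P \<omega>} \<in> events"
      using P Rev by auto
    then have "prob ({\<omega> \<in> ?R. ?P \<omega>} \<union> {\<omega> \<in> space M - ?R. ?P \<omega>})
        = prob {\<omega> \<in> ?R. ?P \<omega>} + prob {\<omega> \<in> space M - ?R. ?P \<omega>}"
      by (intro finite_measure_Union) auto
    also have "{\<omega> \<in> ?R. ?P \<omega>} \<union> {\<omega> \<in> space M - ?R. ?P \<omega>} = {\<omega> \<in> space M. ?P \<omega>}"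
      by (auto simp: rings_def)
    finally show ?thesis .
  qed
  then have "prob {\<omega> \<in> space M. ?P \<omega>} = 1 / 4 * (1 - exp (- (s' - s))) + of_bool (a
      = b) / 2 * exp (- (s' - s))"
    unfolding p1 p2 c prob_rings[OF z s] .
  also have "\<dots> = (1 + exp (- (s' - s)) * real_of_int a * real_of_int b) / 4"
    using a by (auto simp: field_simps)
  finally show ?thesis .
qed

definition site_algebra :: "int \<times> int \<Rightarrow> 'a set set"
  where "site_algebra z = sigma_sets (space M) (\<Union>i\<in>insert (Inl z) (range (\<lambda>k. Inr (z, k))). web_algebra i)"

lemma indep_site_algebra: "indep_sets site_algebra even_lattice"
  unfolding site_algebra_def
proof (rule indep_sets_collect_sigma)
  have "(\<Union>z\<in>even_lattice. insert (Inl z) (range (\<lambda>k. Inr (z, k))))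
      = even_lattice <+> even_lattice \<times> (UNIV :: nat set)"
    by auto
  then show "indep_sets web_algebra (\<Union>z\<in>even_lattice. insert (Inl z) (range (\<lambda>k. Inr (z, k))))"
    using indep_web_algebra by simp
  show "Int_stable (web_algebra i)" for i
    unfolding web_algebra_def Int_stable_def by (auto split: sum.split)
  show "disjoint_family_on (\<lambda>z. insert (Inl z) (range (\<lambda>k. Inr (z, k)))) even_lattice"
    by (auto simp: disjoint_family_on_def)
qed

text \<open>For two different times the clocks influence the correlation of the arrows, so a clock event can be
  carried along only when \<open>s = s'\<close>; then the arrows at time \<open>s\<close> are independent of all clocks.\<close>

lemma prob_xi_cylinder:
  assumes s: "0 \<le> s" "s \<le> s'" and z0: "z0 \<in> even_lattice" and R: "R \<in> sets (clock_algebra z0)"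
    and case_R: "R = space M \<or> s = s'"
    and F: "finite F" "F \<subseteq> even_lattice" and a: "\<And>z. a z \<in> {-1, 1}" and b: "\<And>z. b z \<in> {-1, 1}"
  shows "prob {\<omega> \<in> R. \<forall>z\<in>F. \<xi> z s \<omega> = a z \<and> \<xi> z s' \<omega> = b z} =
    prob R * (\<Prod>z\<in>F. (1 + exp (- (s' - s)) * real_of_int (a z) * real_of_int (b z)) / 4)"
proof -
  have s': "0 \<le> s'" using s by simp
  define q where "q z = (1 + exp (- (s' - s)) * real_of_int (a z) * real_of_int (b z)) / 4" for z
  define C where "C z = {\<omega> \<in> space M. \<xi> z s \<omega> = a z \<and> \<xi> z s' \<omega> = b z}" for z
  define B where "B z = (if z = z0 then R else space M) \<inter> (if z \<in> F then C z else space M)" for z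
  have Rs: "R \<subseteq> space M" using sets.sets_into_space[OF R] by simp
  have qR: "prob (R \<inter> C z0) = prob R * q z0"
  proof (cases "s = s'")
    case True
    have "prob {\<omega> \<in> R. \<xi> z0 s \<omega> = a z0 \<and> \<xi> z0 s' \<omega> = b z0} = of_bool (a z0 = b z0) / 2 * prob R"
      by (rule prob_xi_xi_conditional[OF z0 s(1) s' a b R]) (auto simp: True)
    also have "{\<omega> \<in> R. \<xi> z0 s \<omega> = a z0 \<and> \<xi> z0 s' \<omega> = b z0} = R \<inter> C z0"
      using Rs by (auto simp: C_def)
    finally show ?thesis using True a[of z0] b[of z0] by (auto simp: q_def)
  next
    case False
    then have "R = space M" using case_R by simp
    moreover have "space M \<inter> C z0 = C z0" by (auto simp: C_def)
    ultimately show ?thesis using prob_xi_pair[OF z0 s a b] by (simp add: C_def q_def prob_space)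
  qed
  have B_prob: "prob (B z) = (if z = z0 then prob R else 1) * (if z \<in> F then q z else 1)"
    if z: "z \<in> even_lattice" for z
  proof -
    have "prob (C z) = q z"
      unfolding C_def q_def by (rule prob_xi_pair[OF z s a b])
    moreover have "space M \<inter> C z = C z" "R \<inter> space M = R" using Rs by (auto simp: C_def)
    ultimately show ?thesis
      using qR by (auto simp: B_def prob_space)
  qed
  have B_site: "B z \<in> site_algebra z" if z: "z \<in> even_lattice" for z
  proof -
    let ?G = "\<Union>i\<in>insert (Inl z) (range (\<lambda>k. Inr (z, k))). web_algebra i"
    define N where "N = sigma (space M) ?G"
    have G: "?G \<subseteq> Pow (space M)"
      by (auto simp: web_algebra_def dest!: sets.sets_into_space)
    have setsN: "sets N = site_algebra z" and spaceN: "space N = space M"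
      using G by (auto simp: N_def site_algebra_def space_measure_of_conv)
    have cN: "sets (clock_algebra z) \<subseteq> sets N"
      unfolding setsN site_algebra_def by (auto simp: web_algebra_def)
    have vN: "sets (val_algebra z k) \<subseteq> sets N" for k
      unfolding setsN site_algebra_def by (auto simp: web_algebra_def)
    note [measurable] = xi_measurable[OF z s(1) spaceN cN vN] xi_measurable[OF z s' spaceN cN vN]
    have "C z \<in> sets N"
      unfolding C_def spaceN [symmetric] by measurable
    moreover have "space M \<in> sets N" unfolding spaceN [symmetric] by simp
    ultimately have "B z \<in> sets N" using R cN by (auto simp: B_def)
    then show ?thesis by (simp add: setsN)
  qed
  have I: "insert z0 F \<subseteq> even_lattice" using F z0 by simp
  have "prob (\<Inter>z\<in>insert z0 F. B z) = (\<Prod>z\<in>insert z0 F. prob (B z))"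
    using F I B_site by (intro indep_setsD[OF indep_site_algebra]) auto
  also have "(\<Inter>z\<in>insert z0 F. B z) = {\<omega> \<in> R. \<forall>z\<in>F. \<xi> z s \<omega> = a z \<and> \<xi> z s' \<omega> = b z}"
    using Rs by (auto simp: B_def C_def split: if_splits)
  also have "(\<Prod>z\<in>insert z0 F. prob (B z)) = (\<Prod>z\<in>insert z0 F. (if z
      = z0 then prob R else 1) * (if z \<in> F then q z else 1))"
    using I B_prob by (intro prod.cong) auto
  also have "\<dots> = (\<Prod>z\<in>insert z0 F. if z = z0 then prob R else 1) * (\<Prod>z\<in>insert z0 F. if z \<in> F then q z else 1)"
    by (rule prod.distrib)
  also have "(\<Prod>z\<in>insert z0 F. if z = z0 then prob R else 1) = prob R"
    using F by (simp add: prod.delta)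
  also have "(\<Prod>z\<in>insert z0 F. if z \<in> F then q z else 1) = (\<Prod>z\<in>F. q z)"
    using F by (intro prod.mono_neutral_cong_right) auto
  finally show ?thesis by (simp add: q_def)
qed

lemma correlated_xi:
  assumes s: "0 \<le> s" "s \<le> s'" and z0: "z0 \<in> even_lattice" and R: "R \<in> sets (clock_algebra z0)"
    and case_R: "R = space M \<or> s = s'"
  shows "correlated_environments M (\<lambda>z. \<xi> z s) (\<lambda>z. \<xi> z s') (exp (- (s' - s))) R"
proof
  show "R \<in> events" by (rule clock_algebra_events[OF z0 R])
qed (use s xi_random_variable xi_range prob_xi_cylinder[OF s z0 R case_R] in auto)

section \<open>Good strips at some dynamical time\<close>

lemma sign_env_xi: "0 \<le> s \<Longrightarrow> \<omega> \<in> space M \<Longrightarrow> sign_env (\<lambda>z. \<xi> z s \<omega>)"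
  unfolding sign_env_def using xi_range by blast

lemma origin_in_even_lattice: "(0, 0) \<in> even_lattice"
  by (simp add: even_lattice_def)

lemma space_in_clock_algebra: "space M \<in> sets (clock_algebra z)"
  using sets.top[of "clock_algebra z"] by simp

lemma correlated_xi_space:
  "0 \<le> s \<Longrightarrow> s \<le> s' \<Longrightarrow> correlated_environments M (\<lambda>z. \<xi> z s) (\<lambda>z. \<xi> z s') (exp (- (s' - s))) (space M)"
  by (rule correlated_xi[OF _ _ origin_in_even_lattice space_in_clock_algebra]) auto

definition strip_event :: "nat \<Rightarrow> real \<Rightarrow> 'a set"
  where "strip_event N s = {\<omega> \<in> space M. \<forall>k<N. stays_in_strip (\<lambda>z. \<xi> z s \<omega>) k}"

lemma prob_strip_event_Int:
  assumes s: "0 \<le> s" "s \<le> s'"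
  shows "strip_event N s \<inter> strip_event N s' \<in> events"
    and "prob (strip_event N s \<inter> strip_event N s') = (\<Prod>k<N. strip_pair_prob (exp (- (s' - s))) k)"
proof -
  interpret c: correlated_environments M "\<lambda>z. \<xi> z s" "\<lambda>z. \<xi> z s'" "exp (- (s' - s))" "space M"
    by (rule correlated_xi_space[OF s])
  have Z: "{\<omega> \<in> space M. \<forall>i\<in>{0..<N}. stays_in_strip (\<lambda>z. \<xi> z s \<omega>) i \<and> stays_in_strip (\<lambda>z. \<xi> z s' \<omega>) i}
      = strip_event N s \<inter> strip_event N s'"
    by (auto simp: strip_event_def)
  note i = c.indep_past_strips[of 0 N, unfolded Z, simplified]
  show ev: "strip_event N s \<inter> strip_event N s' \<in> events"
    using i unfolding c.indep_past_def by blast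
  have "space M \<inter> (strip_event N s \<inter> strip_event N s') = strip_event N s \<inter> strip_event N s'"
    using sets.sets_into_space[OF ev] by blast
  then show "prob (strip_event N s \<inter> strip_event N s') = (\<Prod>k<N. strip_pair_prob (exp (- (s' - s))) k)"
    using c.indep_past_prob[OF i] by (simp add: prob_space lessThan_atLeast0)
qed

lemma strip_event_measurable: "0 \<le> s \<Longrightarrow> strip_event N s \<in> events"
  using prob_strip_event_Int(1)[of s s N] by simp

lemma prob_strip_event: "0 \<le> s \<Longrightarrow> prob (strip_event N s) = (\<Prod>k<N. strip_prob k)"
  using prob_strip_event_Int(2)[of s s N] by (simp add: strip_pair_prob_1)

definition curve_event :: "real \<Rightarrow> nat \<Rightarrow> nat \<Rightarrow> real \<Rightarrow> 'a set"
  where "curve_event K j n s = {\<omega> \<in> space M. stays (\<lambda>z. \<xi> z s \<omega>) (curve K j) n 0 0}"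

lemma curve_event_indep_clock:
  assumes s: "0 \<le> s" and z: "z \<in> even_lattice" and R: "R \<in> sets (clock_algebra z)"
  shows "curve_event K j n s \<in> events" "prob (R \<inter> curve_event K j n s) = prob R * surv (curve K j) n 0 0"
proof -
  interpret c: correlated_environments M "\<lambda>z. \<xi> z s" "\<lambda>z. \<xi> z s" "exp (- (s - s))" R
    by (rule correlated_xi[OF s order_refl z R]) simp
  have i: "c.indep_past (c.before 0) (surv (curve K j) n 0 0) (curve_event K j n s)"
    using c.indep_past_stays[of 0 n 1 "space M" 0 0 "curve K j", OF c.indep_past_space]
    by (simp add: curve_event_def pair_surv_diag)
  show "curve_event K j n s \<in> events"
    using i unfolding c.indep_past_def by blast
  show "prob (R \<inter> curve_event K j n s) = prob R * surv (curve K j) n 0 0"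
    by (rule c.indep_past_prob[OF i])
qed

lemma curve_event_measurable: "0 \<le> s \<Longrightarrow> curve_event K j n s \<in> events"
  using curve_event_indep_clock(1)[OF _ origin_in_even_lattice space_in_clock_algebra] .

lemma strip_event_subset_curve_event:
  assumes "0 \<le> s" "11 \<le> K" shows "strip_event n s \<subseteq> curve_event K 8 n s"
proof
  fix \<omega> assume w: "\<omega> \<in> strip_event n s"
  then have "stays (\<lambda>z. \<xi> z s \<omega>) (curve K 8) n 0 0"
    using assms by (intro strips_imp_curve[where N = n] sign_env_xi strip_time_ge) (auto simp:
        strip_event_def)
  then show "\<omega> \<in> curve_event K 8 n s"
    using w by (simp add: curve_event_def strip_event_def)
qed

lemma curve_event_antimono: "m \<le> n \<Longrightarrow> curve_event K j n s \<subseteq> curve_event K j m s"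
  by (auto simp: curve_event_def intro: stays_antimono)

text \<open>The second moment method on the grid of times \<open>i / m\<close>. The off-diagonal terms behave like a Riemann
  sum of the integrable function \<open>1 / sqrt d\<close>.\<close>

lemma prob_exists_strip_event:
  "\<exists>c>0. \<forall>N. c \<le> prob (\<Union>q\<in>\<rat> \<inter> {0..1}. strip_event N q)"
proof -
  define C where "C = sqrt 2 * exp 800"
  have C: "0 < C" by (simp add: C_def)
  have "1 / (1 + 4 * C) \<le> prob (\<Union>q\<in>\<rat> \<inter> {0..1}. strip_event N q)" for N
  proof -
    define p where "p = (\<Prod>k<N. strip_prob k)"
    have "0 < strip_prob k" for k using strip_prob_ge[of k] by linarith
    then have p: "0 < p" by (simp add: p_def prod_pos)
    \<comment> \<open>The grid is fine enough for the expected number of good times to be at least \<open>1\<close>; this controls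
      the diagonal.\<close>
    define m where "m = nat \<lceil>1 / p\<rceil>"
    have m: "1 \<le> m * p" "0 < m"
    proof -
      have "0 < 1 / p" using p by simp
      then show "0 < m" unfolding m_def by linarith
      have "1 / p \<le> m" unfolding m_def by linarith
      then show "1 \<le> m * p" using p by (simp add: field_simps)
    qed
    define A where "A i = strip_event N (i / m)" for i :: nat
    have A: "A i \<in> events" "prob (A i) = p" for i
      by (simp_all add: A_def strip_event_measurable prob_strip_event p_def)
    have lt: "prob (A i \<inter> A j) \<le> p\<^sup>2 * C * sqrt m * (1 / sqrt \<bar>real i - real j\<bar>)" if "i < j" "j < m" for i j
    proof -
      have d: "0 < real j / m - real i / m" "real j / m - real i / m \<le> 1"
        using that m by (auto simp: field_simps)
      have "prob (A i \<inter> A j) = (\<Prod>k<N. strip_pair_prob (exp (- (real j / m - real i / m))) k)"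
        unfolding A_def by (rule prob_strip_event_Int) (use that in \<open>auto intro!: divide_right_mono\<close>)
      also have "\<dots> \<le> p\<^sup>2 * (C / sqrt (real j / m - real i / m))"
        unfolding p_def C_def by (rule prod_strip_pair_prob_le[OF d])
      also have "sqrt (real j / m - real i / m) = sqrt \<bar>real i - real j\<bar> / sqrt m"
        using that by (simp add: diff_divide_distrib [symmetric] real_sqrt_divide)
      finally show ?thesis by simp
    qed
    have ne: "prob (A i \<inter> A j) \<le> p\<^sup>2 * C * sqrt m * (1 / sqrt \<bar>real i - real j\<bar>)" if "i \<noteq> j" "i < m" "j
        < m" for i j
      using lt[of i j] lt[of j i] that by (cases "i < j") (auto simp: Int_commute abs_minus_commute)
    have row: "(\<Sum>j<m. prob (A i \<inter> A j)) \<le> m * p\<^sup>2 * (1 + 4 * C)" if i: "i < m" for i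
    proof -
      have "(\<Sum>j<m. prob (A i \<inter> A j))
          \<le> (\<Sum>j<m. of_bool (j = i) * p + p\<^sup>2 * C * sqrt m * (if j
              = i then 0 else 1 / sqrt \<bar>real i - real j\<bar>))"
        using ne i A by (intro sum_mono) auto
      also have "\<dots> = p + p\<^sup>2 * C * sqrt m * (\<Sum>j<m. if j = i then 0 else 1 / sqrt \<bar>real i - real j\<bar>)"
      proof -
        have "(\<Sum>j<m. of_bool (j = i) * p) = (\<Sum>j<m. if j = i then p else 0)"
          by (intro sum.cong) auto
        then have "(\<Sum>j<m. of_bool (j = i) * p) = p" using i by simp
        then show ?thesis by (simp only: sum.distrib sum_distrib_left)
      qed
      also have "\<dots> \<le> m * p * p + p\<^sup>2 * C * sqrt m * (4 * sqrt m)"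
        using m p C mult_right_mono[OF m(1), of p] sum_inverse_sqrt_dist_le[OF i]
        by (intro add_mono mult_left_mono) auto
      also have "\<dots> = m * p\<^sup>2 * (1 + 4 * C)"
        by (simp add: power2_eq_square algebra_simps)
      finally show ?thesis .
    qed
    have U: "(\<Union>q\<in>\<rat> \<inter> {0..1}. strip_event N q) \<in> events"
      by (intro sets.countable_UN') (auto intro!: strip_event_measurable countable_Int1 countable_rat)
    have "(m * p)\<^sup>2 = (\<Sum>i<m. prob (A i))\<^sup>2" by (simp add: A)
    also have "\<dots> \<le> prob (\<Union>i<m. A i) * (\<Sum>i<m. \<Sum>j<m. prob (A i \<inter> A j))"
      by (rule second_moment) (use A in auto)
    also have "\<dots> \<le> prob (\<Union>q\<in>\<rat> \<inter> {0..1}. strip_event N q) * (\<Sum>i<m. m * p\<^sup>2 * (1 + 4 * C))"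
    proof (intro mult_mono sum_mono row finite_measure_mono U)
      show "(\<Union>i<m. A i) \<subseteq> (\<Union>q\<in>\<rat> \<inter> {0..1}. strip_event N q)"
      proof (intro UN_least)
        fix i assume "i \<in> {..<m}"
        then have "real i / m \<in> \<rat> \<inter> {0..1}" by auto
        then show "A i \<subseteq> (\<Union>q\<in>\<rat> \<inter> {0..1}. strip_event N q)" unfolding A_def by (rule UN_upper)
      qed
    qed (auto intro!: sum_nonneg)
    also have "(\<Sum>i<m. m * p\<^sup>2 * (1 + 4 * C)) = (m * p)\<^sup>2 * (1 + 4 * C)"
      by (simp add: power2_eq_square)
    finally have "(m * p)\<^sup>2 * 1 \<le> (m * p)\<^sup>2 * (prob (\<Union>q\<in>\<rat> \<inter> {0..1}. strip_event N q) * (1 + 4 * C))"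
      by (simp add: mult.left_commute)
    moreover have "0 < (m * p)\<^sup>2" using m p by simp
    ultimately have "1 \<le> prob (\<Union>q\<in>\<rat> \<inter> {0..1}. strip_event N q) * (1 + 4 * C)"
      by (simp only: mult_le_cancel_left_pos)
    then show ?thesis using C by (simp add: field_simps)
  qed
  then show ?thesis using C by (intro exI[of _ "1 / (1 + 4 * C)"]) auto
qed

definition rational_event :: "real \<Rightarrow> nat \<Rightarrow> nat \<Rightarrow> 'a set"
  where "rational_event K j n = (\<Union>q\<in>\<rat> \<inter> {0..1}. curve_event K j n q)"

lemma rational_event_measurable: "rational_event K j n \<in> events"
  unfolding rational_event_def
  by (intro sets.countable_UN') (auto intro!: curve_event_measurable countable_Int1 countable_rat)

text \<open>The events decrease in \<open>n\<close>, so the uniform lower bound survives the intersection.\<close>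

lemma prob_rational_event_pos:
  assumes "11 \<le> K" shows "0 < prob (\<Inter>n. rational_event K 8 n)"
proof -
  obtain c where c: "0 < c" "\<And>N. c \<le> prob (\<Union>q\<in>\<rat> \<inter> {0..1}. strip_event N q)"
    using prob_exists_strip_event by blast
  have "c \<le> prob (rational_event K 8 n)" for n
  proof -
    have "(\<Union>q\<in>\<rat> \<inter> {0..1}. strip_event n q) \<subseteq> rational_event K 8 n"
      unfolding rational_event_def using strip_event_subset_curve_event[OF _ assms] by (intro UN_mono) auto
    then show ?thesis
      using c(2)[of n] finite_measure_mono[OF _ rational_event_measurable] by (meson order.trans)
  qed
  moreover have "(\<lambda>n. prob (rational_event K 8 n)) \<longlonglongrightarrow> prob (\<Inter>n. rational_event K 8 n)"
  proof (rule finite_Lim_measure_decseq)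
    show "decseq (rational_event K 8)"
      unfolding rational_event_def decseq_def using curve_event_antimono by (intro allI impI UN_mono) auto
  qed (use rational_event_measurable in auto)
  ultimately have "c \<le> prob (\<Inter>n. rational_event K 8 n)"
    by (intro LIMSEQ_le_const) auto
  with c(1) show ?thesis by linarith
qed

section \<open>No exceptional behaviour just before a ring\<close>

text \<open>If \<open>z\<close> rings at \<open>\<tau> \<in> (0, 1]\<close> and the left limit of the environment at \<open>\<tau>\<close> respects the barrier up to \<open>n\<close>, then
  this event occurs for all large \<open>m\<close>: take the last grid point before \<open>\<tau>\<close>.\<close>

definition ring_curve_event :: "real \<Rightarrow> nat \<Rightarrow> int \<times> int \<Rightarrow> nat \<Rightarrow> nat \<Rightarrow> 'a set"
  where "ring_curve_event K j z n m = (\<Union>i<m. rings z (i / m) (Suc i / m) \<inter> curve_event K j n (i / m))"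

text \<open>There are \<open>m\<close> grid intervals, a ring in one of them has probability at most \<open>1 / m\<close>, and it is
  independent of the environment at the left endpoint.\<close>

lemma prob_ring_curve_event_le:
  assumes z: "z \<in> even_lattice" and m: "0 < m"
  shows "ring_curve_event K j z n m \<in> events" "prob (ring_curve_event K j z n m) \<le> surv (curve K j) n 0 0"
proof -
  have R: "rings z (i / m) (Suc i / m) \<in> sets (clock_algebra z)" for i
    by (rule rings_in_clock_algebra) auto
  have E: "rings z (i / m) (Suc i / m) \<inter> curve_event K j n (i / m) \<in> events" for i
    by (intro sets.Int clock_algebra_events[OF z R] curve_event_measurable) simp
  then show "ring_curve_event K j z n m \<in> events"
    unfolding ring_curve_event_def by (intro sets.finite_UN) auto
  have "prob (ring_curve_event K j z n m) \<le> (\<Sum>i<m. prob (rings z (i / m) (Suc i / m) \<inter> curve_event K j n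
      (i / m)))"
    unfolding ring_curve_event_def by (rule finite_measure_subadditive_finite) (use E in auto)
  also have "\<dots> \<le> (\<Sum>i<m. 1 / m * surv (curve K j) n 0 0)"
  proof (rule sum_mono)
    fix i
    have d: "real (Suc i) / m - real i / m = 1 / m" by (simp add: diff_divide_distrib [symmetric])
    have "prob (rings z (i / m) (Suc i / m)) = 1 - exp (- (1 / m))"
      using prob_rings[OF z, of "i / m" "Suc i / m"] unfolding d by (simp add: divide_right_mono)
    also have "\<dots> \<le> 1 / m" using exp_ge_add_one_self[of "- (1 / m)"] by linarith
    finally have "prob (rings z (i / m) (Suc i / m)) * surv (curve K j) n 0 0
        \<le> 1 / m * surv (curve K j) n 0 0"
      using surv_bounds by (intro mult_right_mono) auto
    then show "prob (rings z (i / m) (Suc i / m) \<inter> curve_event K j n (i / m))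
        \<le> 1 / m * surv (curve K j) n 0 0"
      using curve_event_indep_clock(2)[OF _ z R] by simp
  qed
  also have "\<dots> = surv (curve K j) n 0 0" using m by simp
  finally show "prob (ring_curve_event K j z n m) \<le> surv (curve K j) n 0 0" .
qed

definition bad_ring_event :: "real \<Rightarrow> nat \<Rightarrow> int \<times> int \<Rightarrow> 'a set"
  where "bad_ring_event K j z = (\<Inter>n. \<Union>k. \<Inter>m\<in>{Suc k..}. ring_curve_event K j z n m)"

text \<open>The bound of \<open>prob_ring_curve_event_le\<close> is uniform in the grid, so it passes to the limit inferior; then
  it tends to \<open>0\<close> with \<open>n\<close>.\<close>

lemma bad_ring_event_null:
  assumes z: "z \<in> even_lattice" and K: "0 < K"
  shows "bad_ring_event K j z \<in> null_sets M"
proof -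
  have I: "(\<Inter>m\<in>{Suc k..}. ring_curve_event K j z n m) \<in> events" for n k
    by (intro sets.countable_INT') (auto intro!: prob_ring_curve_event_le[OF z])
  then have ev: "bad_ring_event K j z \<in> events"
    unfolding bad_ring_event_def by (intro sets.countable_INT sets.countable_UN) (auto intro!: I)
  have le: "prob (\<Union>k. \<Inter>m\<in>{Suc k..}. ring_curve_event K j z n m) \<le> surv (curve K j) n 0 0" for n
  proof (rule LIMSEQ_le_const2)
    show "(\<lambda>k. prob (\<Inter>m\<in>{Suc k..}. ring_curve_event K j z n m)) \<longlonglongrightarrow> prob (\<Union>k. \<Inter>m\<in>{Suc k..}.
        ring_curve_event K j z n m)"
      by (rule finite_Lim_measure_incseq) (use I in \<open>auto simp: incseq_def\<close>)
    have "prob (\<Inter>m\<in>{Suc k..}. ring_curve_event K j z n m) \<le> surv (curve K j) n 0 0" for k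
      by (rule order.trans[OF finite_measure_mono prob_ring_curve_event_le(2)[OF z, of "Suc k"]])
        (auto intro!: prob_ring_curve_event_le[OF z])
    then show "\<exists>N. \<forall>k\<ge>N. prob (\<Inter>m\<in>{Suc k..}. ring_curve_event K j z n m) \<le> surv (curve K j) n 0 0"
      by blast
  qed
  have "prob (bad_ring_event K j z) \<le> surv (curve K j) n 0 0" for n
  proof -
    have "prob (bad_ring_event K j z) \<le> prob (\<Union>k. \<Inter>m\<in>{Suc k..}. ring_curve_event K j z n m)"
      by (intro finite_measure_mono sets.countable_UN) (use I in \<open>auto simp: bad_ring_event_def\<close>)
    with le[of n] show ?thesis by linarith
  qed
  then have "prob (bad_ring_event K j z) < \<epsilon>" if "0 < \<epsilon>" for \<epsilon>
    using surv_curve_small[OF K that, of j] by (meson le_less_trans)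
  then have "prob (bad_ring_event K j z) = 0"
    by (metis less_irrefl measure_nonneg order_le_less)
  then show ?thesis using ev by (simp add: null_sets_def emeasure_eq_measure)
qed

section \<open>Compactness in the dynamical time\<close>

lemma eventually_stays_at_right:
  assumes s: "0 \<le> s" and w: "\<omega> \<in> space M"
  shows "\<forall>\<^sub>F r in at_right s. stays (\<lambda>z. \<xi> z r \<omega>) c n 0 0 = stays (\<lambda>z. \<xi> z s \<omega>) c n 0 0"
proof (rule eventually_stays_eq)
  fix z assume z: "z \<in> even_lattice"
  show "\<forall>\<^sub>F r in at_right s. \<xi> z r \<omega> = \<xi> z s \<omega>"
    using \<xi>_right_continuous[OF z s w] by (simp add: continuous_within tendsto_discrete)
qed (use sign_env_xi[OF s w] in auto)

text \<open>A monotone function with natural values bounded by \<open>clock z s\<close> attains its largest value before \<open>s\<close> and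
  keeps it.\<close>

lemma clock_left_limit:
  assumes z: "z \<in> even_lattice" and s: "0 < s" and w: "\<omega> \<in> space M"
  shows "\<exists>k. \<forall>\<^sub>F r in at_left s. clock z r \<omega> = k"
proof -
  define P where "P k \<longleftrightarrow> (\<exists>r\<in>{0..<s}. clock z r \<omega> = k)" for k
  have "P (clock z 0 \<omega>)" using s by (auto simp: P_def)
  moreover have "\<forall>k. P k \<longrightarrow> k \<le> clock z s \<omega>"
    using clock_mono[OF z w] by (auto simp: P_def)
  ultimately obtain k where k: "P k" "\<And>k'. P k' \<Longrightarrow> k' \<le> k"
    using Nat.ex_has_greatest_nat[of P] by blast
  then obtain r where r: "0 \<le> r" "r < s" "clock z r \<omega> = k" by (auto simp: P_def)
  have "clock z r' \<omega> = k" if "r < r'" "r' < s" for r'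
  proof (rule antisym)
    show "clock z r' \<omega> \<le> k" using r that by (intro k(2)) (auto simp: P_def)
    show "k \<le> clock z r' \<omega>" using clock_mono[OF z w, of r r'] r that by simp
  qed
  then show ?thesis using r by (intro exI[of _ k]) (auto simp: eventually_at_left)
qed

text \<open>Choose for each \<open>n\<close> a time in \<open>[0, 1]\<close> that is good up to \<open>n\<close>, and let \<open>l\<close> be an accumulation point. If
  it is approached from the right, or attained, right-continuity makes \<open>l\<close> good for every \<open>n\<close>. If it is
  approached from the left, then the left limit \<open>e\<close> of the environment is good for every \<open>n\<close>; either
  \<open>e\<close> is the environment at \<open>l\<close>, or some clock \<open>z\<close> rings at \<open>l\<close> and \<open>bad_ring_event K j z\<close> occurs.\<close>

lemma exists_curve_time:
  assumes w: "\<omega> \<in> space M" and r: "\<And>n. \<omega> \<in> rational_event K j n"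
    and bad: "\<And>z. z \<in> even_lattice \<Longrightarrow> \<omega> \<notin> bad_ring_event K j z"
  shows "\<exists>\<tau>\<in>{0..1}. \<forall>n. \<omega> \<in> curve_event K j n \<tau>"
proof -
  define W where "W s n = stays (\<lambda>z. \<xi> z s \<omega>) (curve K j) n 0 0" for s n
  have W: "\<omega> \<in> curve_event K j n s \<longleftrightarrow> W s n" for s n
    using w by (simp add: curve_event_def W_def)
  have anti: "W s n \<Longrightarrow> m \<le> n \<Longrightarrow> W s m" for s m n
    unfolding W_def by (rule stays_antimono)
  have "\<exists>q\<in>{0..1}. W q n" for n
    using r[of n] by (auto simp: rational_event_def W)
  then obtain q where q: "\<And>n. q n \<in> {0..1}" "\<And>n. W (q n) n" by metis
  obtain l \<phi> where l: "l \<in> {0..1}" and \<phi>: "strict_mono \<phi>" and lim: "(q \<circ> \<phi>) \<longlonglongrightarrow> l"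
    using compact_Icc[of 0 "1::real", unfolded compact_def] q(1) by blast
  define u where "u n = q (\<phi> n)" for n
  have u: "u n \<in> {0..1}" for n
    using q(1) by (simp add: u_def)
  have ulim: "u \<longlonglongrightarrow> l"
    using lim by (simp add: u_def [abs_def] comp_def)
  have Wu: "W (u m) n" if "n \<le> m" for n m
    using q(2)[of "\<phi> m"] strict_mono_imp_increasing[OF \<phi>, of m] that unfolding u_def by (meson anti
        order.trans)
  have "\<forall>n. W l n"
  proof (cases "\<exists>\<^sub>F m in sequentially. l \<le> u m")
    case True
    show ?thesis
    proof
      fix n
      have "\<forall>\<^sub>F r in at_right l. W r n = W l n"
        using l unfolding W_def by (intro eventually_stays_at_right w) auto
      then obtain b where b: "l < b" "\<And>r. l < r \<Longrightarrow> r < b \<Longrightarrow> W r n = W l n"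
        using eventually_at_right[of l "l + 1"] by auto
      have "\<forall>\<^sub>F m in sequentially. u m < b" using order_tendstoD(2)[OF ulim b(1)] .
      moreover have "\<forall>\<^sub>F m in sequentially. n \<le> m" by (rule eventually_ge_at_top)
      ultimately have "\<exists>\<^sub>F m in sequentially. l \<le> u m \<and> u m < b \<and> n \<le> m"
        using True by (simp add: frequently_eventually_frequently eventually_conj_iff)
      then obtain m where m: "l \<le> u m" "u m < b" "n \<le> m"
        by (auto dest: frequently_ex)
      show "W l n" using Wu[OF m(3)] b(2)[of "u m"] m by (cases "u m = l") auto
    qed
  next
    case False
    then have ul: "\<forall>\<^sub>F m in sequentially. u m < l" by (simp add: not_frequently not_le)
    then obtain m where "u m < l" by (meson eventually_happens sequentially_bot)
    then have l0: "0 < l" using u[of m] by auto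
    have "\<forall>z\<in>even_lattice. \<exists>k. \<forall>\<^sub>F r in at_left l. clock z r \<omega> = k"
      using clock_left_limit[OF _ l0 w] by blast
    then obtain k where k: "\<And>z. z \<in> even_lattice \<Longrightarrow> \<forall>\<^sub>F r in at_left l. clock z r \<omega> = k z"
      by metis
    define e where "e z = val z (k z) \<omega>" for z
    have pos: "\<forall>\<^sub>F r in at_left l. 0 < r" using l0 eventually_at_left[of 0 l] by auto
    have e: "sign_env e" unfolding sign_env_def e_def using val_range[OF _ w] by auto
    have ev: "\<forall>\<^sub>F r in at_left l. W r n = stays e (curve K j) n 0 0" for n
      unfolding W_def
    proof (rule eventually_stays_eq[OF _ e])
      fix z assume z: "z \<in> even_lattice"
      show "\<forall>\<^sub>F r in at_left l. \<xi> z r \<omega> = e z"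
        using k[OF z] pos by eventually_elim (use \<xi>_eq[OF z _ w] in \<open>auto simp: e_def\<close>)
    qed simp
    have fl: "filterlim u (at_left l) sequentially"
      unfolding filterlim_at using ulim ul by (auto elim: eventually_mono)
    have ste: "stays e (curve K j) n 0 0" for n
    proof -
      have "\<forall>\<^sub>F m in sequentially. W (u m) n = stays e (curve K j) n 0 0"
        using eventually_compose_filterlim[OF ev fl] .
      moreover have "\<forall>\<^sub>F m in sequentially. n \<le> m" by (rule eventually_ge_at_top)
      ultimately have "\<forall>\<^sub>F m in sequentially. stays e (curve K j) n 0 0"
        by eventually_elim (use Wu in auto)
      then show ?thesis by simp
    qed
    show ?thesis
    proof (cases "\<forall>z\<in>even_lattice. k z = clock z l \<omega>")
      case True
      show ?thesis
      proof
        fix n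
        have "\<forall>\<^sub>F m in sequentially. stays (\<lambda>z. \<xi> z l \<omega>) (curve K j) n 0 0 = stays e (curve K j) n 0 0"
          by (rule eventually_stays_eq[OF _ e]) (use True \<xi>_eq[OF _ _ w] l0 in \<open>auto simp: e_def\<close>)
        then show "W l n" using ste by (simp add: W_def)
      qed
    next
      case False
      then obtain z where z: "z \<in> even_lattice" "k z \<noteq> clock z l \<omega>" by blast
      have "\<exists>k. \<forall>m\<in>{Suc k..}. \<omega> \<in> ring_curve_event K j z n m" for n
      proof -
        have "\<forall>\<^sub>F r in at_left l. W r n \<and> clock z r \<omega> = k z"
          using ev[of n] k[OF z(1)] by eventually_elim (use ste in auto)
        then obtain b where b: "b < l" "\<And>r. b < r \<Longrightarrow> r < l \<Longrightarrow> W r n \<and> clock z r \<omega> = k z"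
          using eventually_at_left[of 0 l] l0 by auto
        obtain m0 where m0: "1 / real (Suc m0) < l - b"
          using b(1) nat_approx_posE[of "l - b"] by auto
        have "\<omega> \<in> ring_curve_event K j z n m" if m: "Suc m0 \<le> m" for m
        proof -
          have mpos: "0 < real m" using m by simp
          \<comment> \<open>The grid interval \<open>(i / m, Suc i / m]\<close> that contains \<open>l\<close>.\<close>
          define i where "i = nat \<lceil>m * l\<rceil> - 1"
          have ml: "0 < m * l" "m * l \<le> m" using l l0 mpos by auto
          then have "1 \<le> \<lceil>m * l\<rceil>" "\<lceil>m * l\<rceil> \<le> int m" by (simp_all add: ceiling_le_iff) 
          then have i: "real i < m * l" "m * l \<le> Suc i" "i < m"
            using ml unfolding i_def by linarith+
          have il: "i / m < l" "l \<le> Suc i / m"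
            using i mpos by (simp_all only: pos_divide_less_eq pos_le_divide_eq mult.commute)
          have "1 / real m \<le> 1 / real (Suc m0)" using m by (intro divide_left_mono) auto
          then have "l - 1 / m > b" using m0 by linarith
          moreover have "Suc i / m = i / m + 1 / m" by (simp add: add_divide_distrib)
          ultimately have "b < i / m" using il by linarith
          then have Wi: "W (i / m) n" "clock z (i / m) \<omega> = k z" using b(2) il by auto
          have "clock z (i / m) \<omega> \<le> clock z l \<omega>" "clock z l \<omega> \<le> clock z (Suc i / m) \<omega>"
            using clock_mono[OF z(1) w] il l0 by auto
          then have "\<omega> \<in> rings z (i / m) (Suc i / m)"
            using z(2) Wi(2) w by (auto simp: rings_def)
          then show ?thesis
            using Wi(1) i(3) W unfolding ring_curve_event_def by blast
        qed
        then show ?thesis by (intro exI[of _ m0]) auto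
      qed
      then have "\<omega> \<in> bad_ring_event K j z" unfolding bad_ring_event_def by blast
      then show ?thesis using bad z(1) by blast
    qed
  qed
  then show ?thesis using l W by blast
qed

lemma curve_time_rational:
  assumes t: "\<tau> \<in> {0..1}" and w: "\<omega> \<in> curve_event K j n \<tau>"
  shows "\<omega> \<in> rational_event K j n"
proof (cases "\<tau> = 1")
  case True
  then show ?thesis using w by (auto simp: rational_event_def intro!: bexI[of _ 1])
next
  case False
  have \<omega>: "\<omega> \<in> space M" using w by (simp add: curve_event_def)
  have "\<forall>\<^sub>F r in at_right \<tau>. \<omega> \<in> curve_event K j n r"
    using eventually_stays_at_right[of \<tau> \<omega> "curve K j" n] t w \<omega> by (simp add: curve_event_def)
  then obtain b where b: "\<tau> < b" "\<And>r. \<tau> < r \<Longrightarrow> r < b \<Longrightarrow> \<omega> \<in> curve_event K j n r"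
    using eventually_at_right[of \<tau> "\<tau> + 1"] by auto
  have "\<tau> < min b 1" using b(1) t False by auto
  then obtain r where "r \<in> \<rat>" "\<tau> < r" "r < min b 1" using Rats_dense_in_real by blast
  then show ?thesis using b(2)[of r] t by (auto simp: rational_event_def)
qed

text \<open>Up to the null set \<open>N\<close> of bad rings, the uncountable union over \<open>\<tau>\<close> is the countable union over rational
  times; hence it is measurable for the completion, and its probability is that of \<open>B\<close>.\<close>

lemma prob_exceptional_time_pos:
  assumes K: "11 \<le> K"
  shows "measure (completion M)
    {\<omega> \<in> space M. \<exists>\<tau>\<in>{0..1}. subdiffusive_plus K (web_path (\<lambda>z. \<xi> z \<tau> \<omega>))} > 0"
proof -
  define A where "A = {\<omega> \<in> space M. \<exists>\<tau>\<in>{0..1}. subdiffusive_plus K (web_path (\<lambda>z. \<xi> z \<tau> \<omega>))}"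
  have A: "\<omega> \<in> A \<longleftrightarrow> (\<exists>j. \<exists>\<tau>\<in>{0..1}. \<forall>n. \<omega> \<in> curve_event K j n \<tau>)" for \<omega>
  proof -
    have "subdiffusive_plus K (web_path (\<lambda>z. \<xi> z \<tau> \<omega>)) \<longleftrightarrow> (\<exists>j. \<forall>n. stays (\<lambda>z. \<xi> z \<tau> \<omega>) (curve K j) n 0 0)"
      if "\<tau> \<in> {0..1}" "\<omega> \<in> space M" for \<tau>
      using that K by (intro subdiffusive_iff_stays sign_env_xi) auto
    then show ?thesis unfolding A_def curve_event_def by blast
  qed
  define B where "B = (\<Union>j. \<Inter>n. rational_event K j n)"
  define N where "N = (\<Union>j. \<Union>z\<in>even_lattice. bad_ring_event K j z)"
  have N: "N \<in> null_sets M"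
    unfolding N_def using K by (intro null_sets_UN null_sets_UN' bad_ring_event_null) auto
  have Bev: "B \<in> events"
    unfolding B_def using rational_event_measurable by (intro sets.countable_UN sets.countable_INT) auto
  have AB: "A \<subseteq> B"
  proof
    fix \<omega> assume "\<omega> \<in> A"
    then obtain j \<tau> where "\<tau> \<in> {0..1}" "\<And>n. \<omega> \<in> curve_event K j n \<tau>"
      unfolding A by blast
    then have "\<omega> \<in> rational_event K j n" for n
      by (rule curve_time_rational)
    then show "\<omega> \<in> B" by (auto simp: B_def)
  qed
  have BA: "B - N \<subseteq> A"
  proof
    fix \<omega> assume "\<omega> \<in> B - N"
    then obtain j where j: "\<And>n. \<omega> \<in> rational_event K j n" and n: "\<And>z. z \<in> even_lattice \<Longrightarrow> \<omega> \<notin>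
        bad_ring_event K j z"
      by (auto simp: B_def N_def)
    have "\<omega> \<in> space M" using j[of 0] sets.sets_into_space[OF rational_event_measurable] by blast
    then show "\<omega> \<in> A" unfolding A by (intro exI[of _ j] exists_curve_time j n)
  qed
  interpret C: prob_space "completion M" by (rule prob_space_completion)
  have "A = (B - N) \<union> (A \<inter> N)" using AB BA by auto
  moreover have "A \<inter> N \<in> sets (completion M)" by (rule null_sets_completion[OF N]) auto
  moreover have "B - N \<in> events" using Bev N by auto
  ultimately have Aev: "A \<in> sets (completion M)"
    by (metis sets.Un sets_completionI_sets)
  have "0 < prob (\<Inter>n. rational_event K 8 n)" by (rule prob_rational_event_pos[OF K])
  also have "\<dots> \<le> prob B"
    by (intro finite_measure_mono Bev) (auto simp: B_def)
  also have "prob B = prob (B - N)"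
    using measure_Diff_null_set[OF Bev N] by simp
  also have "\<dots> = measure (completion M) (B - N)"
    using Bev N by (intro measure_completion [symmetric]) auto
  also have "\<dots> \<le> measure (completion M) A"
    by (rule C.finite_measure_mono[OF BA Aev])
  finally show ?thesis by (simp add: A_def)
qed

end

theorem proposition4p1:
  fixes M :: "'a measure"
    and clock :: "int \<times> int \<Rightarrow> real \<Rightarrow> 'a \<Rightarrow> nat"
    and val :: "int \<times> int \<Rightarrow> nat \<Rightarrow> 'a \<Rightarrow> int"
    and \<xi> :: "int \<times> int \<Rightarrow> real \<Rightarrow> 'a \<Rightarrow> int"
  assumes "dynamical_discrete_web M clock val \<xi>"
  shows "\<exists>K\<^sub>0>0. \<forall>K\<ge>K\<^sub>0.
    measure (completion M)
      {\<omega> \<in> space M. \<exists>\<tau>\<in>{0..1}. subdiffusive_plus K (web_path (\<lambda>z. \<xi> z \<tau> \<omega>))} > 0"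
proof -
  interpret dynamical_discrete_web M clock val \<xi> by (rule assms)
  show ?thesis
    by (intro exI[of _ 11]) (use prob_exceptional_time_pos in auto)
qed

end
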